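(* Let $a,b,c,\mu\in\mathbb{C}$. In each identity below assume that the arguments of the three gamma functions in the numerator on the right-hand side have positive real parts, and that the lower (third) parameters of the hypergeometric functions in the two $w_j$'s occurring are not in $\mathbb{Z}_{\le0}$. (1) For $x\in(-\infty,0)\cup(1,\infty)$: $$\int_0^1(1-y)^{a-\mu-1}w_2(y;a,b,c)|x-y|^{\mu-1}dy=\frac{\Gamma(c-b-\mu)\Gamma(a-\mu)\Gamma(2-c)}{\Gamma(a-b-\mu+1)\Gamma(1-\mu)}\,|x-1|^{a-1}w_3(x;a-\mu,b,c-\mu).$$ (2) For $x\in(-\infty,0)\cup(0,1)$: $$\int_1^\infty(y-1)^{a-\mu-1}w_4(y;a,b,c)(y-x)^{\mu-1}dy=\frac{\Gamma(c-b-\mu)\Gamma(a-\mu)\Gamma(b-a+1)}{\Gamma(c-\mu)\Gamma(1-\mu)}\,|1-x|^{a-1}w_1(x;a-\mu,b,c-\mu).$$ (3) For $x\in(-\infty,0)\cup(1,\infty)$: $$\int_0^1(1-y)^{b-\mu-1}w_2(y;a,b,c)|x-y|^{\mu-1}dy=\frac{\Gamma(c-a-\mu)\Gamma(b-\mu)\Gamma(2-c)}{\Gamma(b-a-\mu+1)\Gamma(1-\mu)}\,|x-1|^{b-1}w_4(x;a,b-\mu,c-\mu).$$ (4) For $x\in(-\infty,0)\cup(0,1)$: $$\int_1^\infty(y-1)^{b-\mu-1}w_3(y;a,b,c)(y-x)^{\mu-1}dy=\frac{\Gamma(c-a-\mu)\Gamma(b-\mu)\Gamma(a-b+1)}{\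Gamma(c-\mu)\Gamma(1-\mu)}\,|1-x|^{b-1}w_1(x;a,b-\mu,c-\mu).$$
   Context: Write $F(a,b;c;z)={}_2F_1(a,b;c;z)$ for the Gauss hypergeometric function (power series for $|z|<1$, analytically continued to $\mathbb{C}\setminus[1,\infty)$, with $c\notin\mathbb{Z}_{\le0}$). Define $w_1(x;a,b,c)=F(a,b;c;x)$ for $x\in(-\infty,1)$; $w_2(x;a,b,c)=|x|^{1-c}F(a-c+1,b-c+1;2-c;x)$ for $x\in(-\infty,0)\cup(0,1)$; $w_3(x;a,b,c)=|x|^{-a}F(a,a-c+1;a-b+1;x^{-1})$ for $x\in(-\infty,0)\cup(1,\infty)$; $w_4(x;a,b,c)=|x|^{-b}F(b,b-c+1;b-a+1;x^{-1})$ for $x\in(-\infty,0)\cup(1,\infty)$. Convention: $1/\Gamma$ is entire, with value $0$ at nonpositive integers. *)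

theory Defs
  imports "HOL-Analysis.Analysis"
begin

lemma eval_fps_hypergeo_2_1:
  fixes a b c z :: complex
  shows "eval_fps (fps_hypergeo [a, b] [c] 1) z =
    (\<Sum>n. pochhammer a n * pochhammer b n / (pochhammer c n * fact n) * z ^ n)"
  by (simp add: eval_fps_def)

text \<open>
  The principal branch of the Gauss hypergeometric function: the value at \<open>z\<close> of the holomorphic
  function on the complex plane cut along \<open>[1,\<infinity>)\<close> that agrees with the power series on the unit
  disc. By the identity theorem there is at most one such function, so the value is determined
  for \<open>z\<close> off the cut; on the cut it is unspecified.
  The parameter \<open>c\<close> is meant to lie outside \<open>\<int>\<^sub>\<le>\<^sub>0\<close>.
\<close>

definition hyp2F1 :: "complex \<Rightarrow> complex \<Rightarrow> complex \<Rightarrow> complex \<Rightarrow> complex" where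
  "hyp2F1 a b c z = (THE w. \<exists>f. f holomorphic_on (- complex_of_real ` {1..}) \<and>
     (\<forall>u\<in>ball 0 1. f u = eval_fps (fps_hypergeo [a, b] [c] 1) u) \<and> f z = w)"

text \<open>
  The four local solutions on the real line. They are meant on \<open>(-\<infinity>,1)\<close>, on
  \<open>(-\<infinity>,0) \<union> (0,1)\<close>, and (the last two) on \<open>(-\<infinity>,0) \<union> (1,\<infinity>)\<close>; powers of positive
  reals are the principal ones.
\<close>

definition w1 :: "real \<Rightarrow> complex \<Rightarrow> complex \<Rightarrow> complex \<Rightarrow> complex" where
  "w1 x a b c = hyp2F1 a b c (of_real x)"

definition w2 :: "real \<Rightarrow> complex \<Rightarrow> complex \<Rightarrow> complex \<Rightarrow> complex" where
  "w2 x a b c =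
     of_real \<bar>x\<bar> powr (1 - c) * hyp2F1 (a - c + 1) (b - c + 1) (2 - c) (of_real x)"

definition w3 :: "real \<Rightarrow> complex \<Rightarrow> complex \<Rightarrow> complex \<Rightarrow> complex" where
  "w3 x a b c =
     of_real \<bar>x\<bar> powr (- a) * hyp2F1 a (a - c + 1) (a - b + 1) (of_real (inverse x))"

definition w4 :: "real \<Rightarrow> complex \<Rightarrow> complex \<Rightarrow> complex \<Rightarrow> complex" where
  "w4 x a b c =
     of_real \<bar>x\<bar> powr (- b) * hyp2F1 b (b - c + 1) (b - a + 1) (of_real (inverse x))"

end

theory Submission
  imports Defs "HOL-Complex_Analysis.Complex_Analysis" "HOL-Real_Asymp.Real_Asymp"
begin

text \<open>
  All four identities are instances of one formula: with \<open>\<sigma> = C + \<rho> - A\<close> and \<open>z < 1\<close>, the integral of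
  \<open>s\<^sup>C\<^sup>-\<^sup>1 (1 - s)\<^sup>\<rho>\<^sup>-\<^sup>1 F(A,B;C;s) (1 - z s)\<^sup>-\<^sup>\<sigma>\<close> over \<open>(0,1)\<close> is a constant times
  \<open>(1 - z)\<^sup>A\<^sup>-\<^sup>C F(\<rho>,A;C+\<rho>-B;z)\<close>; the integrals over \<open>(1,\<infinity>)\<close> are brought into this form by \<open>y = 1/s\<close>.
  Put \<open>t = 1 - s\<close> and \<open>u = z / (z - 1)\<close>, so that \<open>1 - z s = (1 - z) (1 - u t)\<close>, and expand
  \<open>(1 - u t)\<^sup>-\<^sup>\<sigma>\<close> in powers of \<open>u\<close>. The moments of the weight in \<open>t\<close> are products of Gamma functions by
  Gauss's summation theorem, and the choice of \<open>\<sigma>\<close> cancels the factor \<open>(\<sigma>)\<^sub>n\<close>, so that the sum is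
  \<open>F\<close> again, at \<open>u\<close>; the identity theorem extends this to the plane cut along \<open>[1,\<infinity>)\<close>, and Pfaff's
  transformation returns from \<open>u\<close> to \<open>z\<close>.

  The continuation of the hypergeometric series to the cut plane is obtained from Euler's
  integral when \<open>Re c > Re b > 0\<close>, and otherwise from that case by the first-order differential
  operators which lower \<open>b\<close> and \<open>c\<close> by one.
\<close>

section \<open>Gauss's summation theorem\<close>

definition hyp_coeff :: "complex \<Rightarrow> complex \<Rightarrow> complex \<Rightarrow> nat \<Rightarrow> complex" where
  "hyp_coeff a b c n = pochhammer a n * pochhammer b n / (pochhammer c n * fact n)"

lemma pochhammer_neq_0: "c \<notin> \<int>\<^sub>\<le>\<^sub>0 \<Longrightarrow> pochhammer (c::complex) n \<noteq> 0"
  by (auto simp: pochhammer_eq_0_iff)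

lemma pochhammer_plus1: "c * pochhammer (c + 1) n = (c + of_nat n) * pochhammer (c::'a::comm_ring_1) n"
  using pochhammer_rec[of c n] pochhammer_Suc[of c n] by (simp add: mult.commute)

lemma not_nonpos_Int_add_of_nat: "(c::complex) \<notin> \<int>\<^sub>\<le>\<^sub>0 \<Longrightarrow> c + of_nat n \<notin> \<int>\<^sub>\<le>\<^sub>0"
  using plus_of_nat_eq_0_imp[of c] nonpos_Ints_diff_Nats[of "c + of_nat n" "of_nat n"] by auto

lemma Re_pos_not_nonpos_Int: "0 < Re c \<Longrightarrow> c \<notin> \<int>\<^sub>\<le>\<^sub>0"
  by (auto elim!: nonpos_Ints_cases)

section \<open>Growth of Pochhammer symbols and of hypergeometric coefficients\<close>

text \<open>This is the limit of \<open>rGamma_series\<close> taken in norm, since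
  \<open>exp (z * ln n)\<close> has modulus \<open>n powr Re z\<close>. Powers of
  \<open>Suc n\<close> keep the denominator positive at \<open>n = 0\<close>, so that the bounds
  drawn from it hold for every n.\<close>

lemma pochhammer_norm_asymp:
  fixes z :: complex
  shows "(\<lambda>n. norm (pochhammer z n) / (fact n * real (Suc n) powr (Re z - 1))) \<longlonglongrightarrow> norm (rGamma z)"
proof -
  have 1: "(\<lambda>n. norm (rGamma_series z n)) \<longlonglongrightarrow> norm (rGamma z)"
    by (intro tendsto_norm rGamma_series_LIMSEQ)
  \<comment> \<open>With x for \<open>Re z\<close>, this compares the denominator
    \<open>fact n * n powr x\<close> of \<open>rGamma_series\<close> at n with the denominator
    \<open>fact (Suc n) * Suc (Suc n) powr (x - 1)\<close> of the claim at
    \<open>Suc n\<close>.\<close>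
  have 2: "(\<lambda>n. real n powr x / (real (Suc n) * real (Suc (Suc n)) powr (x - 1))) \<longlonglongrightarrow> 1" for x
    by real_asymp
  have "(\<lambda>n. norm (rGamma_series z n) *
           (real n powr Re z / (real (Suc n) * real (Suc (Suc n)) powr (Re z - 1)))) \<longlonglongrightarrow> norm (rGamma z) * 1"
    by (intro tendsto_mult 1 2)
  moreover have "eventually (\<lambda>n. norm (rGamma_series z n) *
           (real n powr Re z / (real (Suc n) * real (Suc (Suc n)) powr (Re z - 1))) =
         norm (pochhammer z (Suc n)) / (fact (Suc n) * real (Suc (Suc n)) powr (Re z - 1))) sequentially"
    using eventually_gt_at_top[of 0]
  proof eventually_elim
    case (elim n)
    have "norm (exp (z * of_real (ln (real n)))) = real n powr Re z"
      using elim by (simp add: powr_def mult.commute)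
    thus ?case using elim
      by (simp add: rGamma_series_def norm_divide norm_mult field_simps del: pochhammer_Suc of_nat_Suc)
  qed
  ultimately have "(\<lambda>n. norm (pochhammer z (Suc n)) / (fact (Suc n) * real (Suc (Suc n)) powr (Re z - 1)))
         \<longlonglongrightarrow> norm (rGamma z)"
    by (simp only: mult_1_right filterlim_cong[OF refl refl])
  thus ?thesis by (rule LIMSEQ_imp_Suc)
qed

lemma pochhammer_upper_bound:
  fixes z :: complex
  obtains K where "K > 0" "\<And>n. norm (pochhammer z n) \<le> K * (fact n * real (Suc n) powr (Re z - 1))"
proof -
  have "Bseq (\<lambda>n. norm (pochhammer z n) / (fact n * real (Suc n) powr (Re z - 1)))"
    using pochhammer_norm_asymp convergent_imp_Bseq convergentI by blast
  then obtain K where K: "K > 0"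
    "\<And>n. norm (norm (pochhammer z n) / (fact n * real (Suc n) powr (Re z - 1))) \<le> K"
    by (rule BseqE) auto
  show ?thesis
  proof (rule that[OF K(1)])
    fix n show "norm (pochhammer z n) \<le> K * (fact n * real (Suc n) powr (Re z - 1))"
      using K(2)[of n] by (simp add: field_simps abs_mult)
  qed
qed

text \<open>Off the nonpositive integers the limit \<open>norm (rGamma z)\<close> is nonzero, so the
  inverse quotients converge as well and are bounded.\<close>

lemma pochhammer_lower_bound:
  fixes z :: complex
  assumes "z \<notin> \<int>\<^sub>\<le>\<^sub>0"
  obtains K where "K > 0" "\<And>n. fact n * real (Suc n) powr (Re z - 1) \<le> K * norm (pochhammer z n)"
proof -
  have "(\<lambda>n. inverse (norm (pochhammer z n) / (fact n * real (Suc n) powr (Re z - 1)))) \<longlonglongrightarrow> inverse (norm (rGamma z))"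
    using assms by (intro tendsto_inverse pochhammer_norm_asymp) (auto simp: rGamma_eq_zero_iff)
  hence "Bseq (\<lambda>n. inverse (norm (pochhammer z n) / (fact n * real (Suc n) powr (Re z - 1))))"
    using convergent_imp_Bseq convergentI by blast
  then obtain K where K: "K > 0"
    "\<And>n. norm (inverse (norm (pochhammer z n) / (fact n * real (Suc n) powr (Re z - 1)))) \<le> K"
    by (rule BseqE) auto
  show ?thesis
  proof (rule that[OF K(1)])
    fix n show "fact n * real (Suc n) powr (Re z - 1) \<le> K * norm (pochhammer z n)"
      using K(2)[of n] pochhammer_neq_0[OF assms, of n] by (simp add: field_simps abs_mult)
  qed
qed

text \<open>The factorials cancel and the exponents combine to
  \<open>(Re a - 1) + (Re b - 1) - (Re c - 1)\<close>. Convergence at 1 is thereby governed by the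
  sign of \<open>Re (c - a - b)\<close>.\<close>

lemma hyp_coeff_bound:
  assumes "c \<notin> \<int>\<^sub>\<le>\<^sub>0"
  obtains K where "K > 0" "\<And>n. norm (hyp_coeff a b c n) \<le> K * real (Suc n) powr (Re (a + b - c) - 1)"
proof -
  obtain Ka where Ka: "Ka > 0" "\<And>n. norm (pochhammer a n) \<le> Ka * (fact n * real (Suc n) powr (Re a - 1))"
    using pochhammer_upper_bound[of a] by blast
  obtain Kb where Kb: "Kb > 0" "\<And>n. norm (pochhammer b n) \<le> Kb * (fact n * real (Suc n) powr (Re b - 1))"
    using pochhammer_upper_bound[of b] by blast
  obtain Kc where Kc: "Kc > 0" "\<And>n. fact n * real (Suc n) powr (Re c - 1) \<le> Kc * norm (pochhammer c n)"
    using pochhammer_lower_bound[OF assms] by blast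
  show ?thesis
  proof (rule that)
    show "Ka * Kb * Kc > 0" using Ka Kb Kc by simp
    fix n
    define N where "N = real (Suc n)"
    have N: "N > 0" by (simp add: N_def)
    have "norm (hyp_coeff a b c n) = norm (pochhammer a n) * norm (pochhammer b n) / (norm (pochhammer c n) * fact n)"
      by (simp add: hyp_coeff_def norm_divide norm_mult)
    also have "\<dots> \<le> (Ka * (fact n * N powr (Re a - 1))) * (Kb * (fact n * N powr (Re b - 1))) /
       ((fact n * N powr (Re c - 1)) / Kc * fact n)"
      using Ka Kb Kc[of] N unfolding N_def
      by (intro frac_le mult_mono mult_right_mono mult_nonneg_nonneg mult_pos_pos divide_pos_pos)
         (auto simp: field_simps)
    also have "\<dots> = Ka * Kb * Kc * (N powr (Re a - 1) * N powr (Re b - 1) / N powr (Re c - 1))"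
      using Kc N by (simp add: field_simps)
    also have "N powr (Re a - 1) * N powr (Re b - 1) / N powr (Re c - 1) = N powr (Re (a + b - c) - 1)"
      using N by (simp flip: powr_add powr_diff add: algebra_simps)
    finally show "norm (hyp_coeff a b c n) \<le> Ka * Kb * Kc * real (Suc n) powr (Re (a + b - c) - 1)"
      by (simp add: N_def)
  qed
qed

lemma summable_Suc_powr: "s < -1 \<Longrightarrow> summable (\<lambda>n. real (Suc n) powr s)"
  by (subst summable_Suc_iff) (simp add: summable_real_powr_iff)

lemma summable_norm_hyp_coeff:
  assumes "c \<notin> \<int>\<^sub>\<le>\<^sub>0" "0 < Re (c - a - b)"
  shows "summable (\<lambda>n. norm (hyp_coeff a b c n))"
proof -
  obtain K where K: "K > 0" "\<And>n. norm (hyp_coeff a b c n) \<le> K * real (Suc n) powr (Re (a + b - c) - 1)"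
    using hyp_coeff_bound[OF assms(1), of a b] by blast
  show ?thesis
    using K assms(2) by (intro summable_comparison_test'[OF summable_mult[OF summable_Suc_powr]]) auto
qed

text \<open>Up to the factor \<open>- c\<close> this is the boundary term at infinity of the
  telescoping sum in \<open>Gauss_contiguity\<close>. The factor n raises the exponent of
  \<open>hyp_coeff_bound\<close> by one, to \<open>Re (a + b - c)\<close>, which is still
  negative.\<close>

lemma hyp_coeff_times_n_tendsto_0:
  assumes "c \<notin> \<int>\<^sub>\<le>\<^sub>0" "0 < Re (c - a - b)"
  shows "(\<lambda>n. of_nat n * hyp_coeff a b c n) \<longlonglongrightarrow> 0"
proof -
  obtain K where K: "K > 0" "\<And>n. norm (hyp_coeff a b c n) \<le> K * real (Suc n) powr (Re (a + b - c) - 1)"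
    using hyp_coeff_bound[OF assms(1), of a b] by blast
  have "Re (a + b - c) < 0" using assms(2) by simp
  hence "(\<lambda>n. K * real (Suc n) powr Re (a + b - c)) \<longlonglongrightarrow> K * 0"
    by (intro tendsto_mult tendsto_const tendsto_neg_powr) (auto simp del: of_nat_Suc intro: filterlim_compose[OF filterlim_real_sequentially filterlim_Suc])
  hence lim: "(\<lambda>n. K * real (Suc n) powr Re (a + b - c)) \<longlonglongrightarrow> 0" by simp
  have "norm (of_nat n * hyp_coeff a b c n) \<le> K * real (Suc n) powr Re (a + b - c)" for n
  proof -
    have "norm (of_nat n * hyp_coeff a b c n) \<le> real (Suc n) * (K * real (Suc n) powr (Re (a + b - c) - 1))"
      unfolding norm_mult using K by (intro mult_mono) auto
    also have "\<dots> = K * (real (Suc n) powr 1 * real (Suc n) powr (Re (a + b - c) - 1))"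
      by (simp del: of_nat_Suc)
    also have "\<dots> = K * real (Suc n) powr Re (a + b - c)"
      by (subst powr_add [symmetric]) (simp add: add_diff_eq)
    finally show ?thesis .
  qed
  thus ?thesis
    by (intro Lim_null_comparison[OF always_eventually lim] allI)
qed

section \<open>Gauss's theorem by shifting c to infinity\<close>

text \<open>With \<open>t\<^sub>n\<close> the coefficients, the difference of the two sides telescopes with \<open>- c n t\<^sub>n\<close>.\<close>

lemma Gauss_contiguity:
  assumes c: "c \<notin> \<int>\<^sub>\<le>\<^sub>0" and abc: "0 < Re (c - a - b)"
  shows "c * (c - a - b) * (\<Sum>n. hyp_coeff a b c n) = (c - a) * (c - b) * (\<Sum>n. hyp_coeff a b (c + 1) n)"
proof -
  let ?t = "hyp_coeff a b c"
  let ?G = "\<lambda>n. - (c * (of_nat n * ?t n))"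
  have c1: "c + 1 \<notin> \<int>\<^sub>\<le>\<^sub>0" using not_nonpos_Int_add_of_nat[OF c, of 1] by simp
  have c0: "c + of_nat n \<noteq> 0" for n using not_nonpos_Int_add_of_nat[OF c, of n] by auto
  have eq: "c * (c - a - b) * ?t n - (c - a) * (c - b) * hyp_coeff a b (c + 1) n = ?G (Suc n) - ?G n" for n
  proof -
    have p: "pochhammer (c + 1) n = (c + of_nat n) * pochhammer c n / c"
      using c pochhammer_plus1[of c n] by (auto simp: eq_divide_eq mult.commute)
    have 1: "hyp_coeff a b (c + 1) n = ?t n * (c / (c + of_nat n))"
      unfolding hyp_coeff_def p using c by auto
    have 2: "of_nat (Suc n) * ?t (Suc n) = ?t n * ((a + of_nat n) * (b + of_nat n) / (c + of_nat n))"
      by (simp add: hyp_coeff_def pochhammer_Suc mult_ac del: of_nat_Suc)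
    show ?thesis unfolding 1 2 using c0[of n] by (simp add: field_simps)
  qed
  have s1: "summable ?t" using summable_norm_cancel[OF summable_norm_hyp_coeff[OF c abc]] .
  have s2: "summable (hyp_coeff a b (c + 1))"
    using summable_norm_cancel[OF summable_norm_hyp_coeff[OF c1, of a b]] abc by simp
  have "?G \<longlonglongrightarrow> - (c * 0)"
    by (intro tendsto_intros hyp_coeff_times_n_tendsto_0 c abc)
  hence "(\<lambda>n. ?G (Suc n) - ?G n) sums (0 - ?G 0)"
    by (intro telescope_sums) simp
  hence "(\<lambda>n. c * (c - a - b) * ?t n - (c - a) * (c - b) * hyp_coeff a b (c + 1) n) sums 0"
    unfolding eq by simp
  moreover have "(\<lambda>n. c * (c - a - b) * ?t n - (c - a) * (c - b) * hyp_coeff a b (c + 1) n) sums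
     (c * (c - a - b) * suminf ?t - (c - a) * (c - b) * suminf (hyp_coeff a b (c + 1)))"
    by (intro sums_diff sums_mult summable_sums s1 s2)
  ultimately show ?thesis using sums_unique2 by fastforce
qed

text \<open>Pushing c to the right by m steps collects the four Pochhammer symbols which, suitably
  normalised, tend to reciprocal Gamma values.\<close>

lemma Gauss_contiguity_iterated:
  assumes c: "c \<notin> \<int>\<^sub>\<le>\<^sub>0" and abc: "0 < Re (c - a - b)"
  shows "pochhammer c m * pochhammer (c - a - b) m * (\<Sum>n. hyp_coeff a b c n) =
           pochhammer (c - a) m * pochhammer (c - b) m * (\<Sum>n. hyp_coeff a b (c + of_nat m) n)"
proof (induction m)
  case (Suc m)
  have "(c + of_nat m) * (c + of_nat m - a - b) * (\<Sum>n. hyp_coeff a b (c + of_nat m) n) =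
     (c + of_nat m - a) * (c + of_nat m - b) * (\<Sum>n. hyp_coeff a b (c + of_nat m + 1) n)"
    using not_nonpos_Int_add_of_nat[OF c] abc by (intro Gauss_contiguity) auto
  moreover have "c + of_nat m - a - b = c - a - b + of_nat m" "c + of_nat m - a = c - a + of_nat m"
    "c + of_nat m - b = c - b + of_nat m" "c + of_nat (Suc m) = c + of_nat m + 1" by simp_all
  ultimately show ?case using Suc.IH unfolding pochhammer_Suc by (simp only:) algebra
qed simp

lemma hyp_coeff_0 [simp]: "hyp_coeff a b c 0 = 1"
  by (simp add: hyp_coeff_def)

text \<open>As the lower parameter moves to the right every term except the first tends to 0, and
  Tannery's theorem allows the limit under the sum.\<close>

lemma hyp_coeff_sum_tendsto_1:
  "(\<lambda>m. \<Sum>n. hyp_coeff a b (c + of_nat m) n) \<longlonglongrightarrow> 1"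
proof -
  \<comment> \<open>The coefficients with lower parameter X serve as majorant: X exceeds
    \<open>Re a + Re b\<close>, which makes them summable, and it is positive, which makes the
    comparison of Pochhammer symbols factor by factor possible.\<close>
  define X where "X = max 1 (Re a + Re b + 1)"
  have X: "X > 0" "0 < Re (of_real X - a - b)" by (auto simp: X_def)
  have ev: "eventually (\<lambda>m. X \<le> Re (c + of_nat m)) sequentially"
    using eventually_ge_at_top[of "nat \<lceil>X - Re c\<rceil>"] by eventually_elim (simp; linarith)
  have lim: "(\<lambda>m. hyp_coeff a b (c + of_nat m) k) \<longlonglongrightarrow> (if k = 0 then 1 else 0)" for k
  proof (cases k)
    case (Suc j)
    have "filterlim (\<lambda>m. c + of_nat m) at_infinity sequentially"
      by (intro tendsto_add_filterlim_at_infinity[OF tendsto_const] tendsto_of_nat)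
    hence 1: "(\<lambda>m. inverse (c + of_nat m)) \<longlonglongrightarrow> 0"
      by (rule filterlim_compose[OF tendsto_inverse_0])
    have "eventually (\<lambda>m. norm (hyp_coeff a b (c + of_nat m) k) \<le>
        norm (inverse (c + of_nat m)) * norm (pochhammer a k * pochhammer b k)) sequentially"
      using ev
    proof eventually_elim
      case (elim m)
      \<comment> \<open>Of \<open>pochhammer (c + m) k\<close> only the first factor
        \<open>c + m\<close> is kept, all others having modulus at least 1; the term is thus of
        order \<open>1 / (c + m)\<close>.\<close>
      have ge1: "norm (pochhammer (c + of_nat m + 1) j) \<ge> 1"
        unfolding pochhammer_prod prod_norm[symmetric]
      proof (rule prod_ge_1)
        fix i assume "i \<in> {0..<j}"
        have "1 \<le> Re (c + of_nat m + 1 + of_nat i)" using elim X by simp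
        thus "1 \<le> norm (c + of_nat m + 1 + of_nat i)" using complex_Re_le_cmod order_trans by blast
      qed
      have nz: "c + of_nat m \<noteq> 0" using elim X by (metis less_le_not_le zero_complex.simps(1))
      have "norm (hyp_coeff a b (c + of_nat m) k) = norm (pochhammer a k * pochhammer b k) /
          (norm (c + of_nat m) * (norm (pochhammer (c + of_nat m + 1) j) * fact k))"
        unfolding hyp_coeff_def norm_divide norm_mult norm_fact
        by (simp add: Suc pochhammer_rec[of "c + of_nat m"] norm_mult mult_ac)
      also have "\<dots> \<le> norm (pochhammer a k * pochhammer b k) / (norm (c + of_nat m) * (1 * 1))"
        using nz ge1 by (intro divide_left_mono mult_left_mono mult_mono mult_pos_pos)
          (auto simp del: fact_Suc intro: less_le_trans[OF zero_less_one] fact_ge_1)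
      finally show ?case by (simp add: norm_inverse divide_inverse mult.commute)
    qed
    hence "(\<lambda>m. hyp_coeff a b (c + of_nat m) k) \<longlonglongrightarrow> 0"
      by (rule Lim_null_comparison) (intro tendsto_mult_left_zero tendsto_norm_zero 1)
    thus ?thesis by (simp add: Suc)
  qed auto
  define M where "M = (\<lambda>k. norm (hyp_coeff a b (of_real X) k))"
  have bound: "eventually (\<lambda>(k, m). norm (hyp_coeff a b (c + of_nat m) k) \<le> M k) (at_top \<times>\<^sub>F sequentially)"
    unfolding case_prod_unfold
  proof (rule eventually_mono[OF eventually_prodI[OF always_eventually[OF allI[OF TrueI]] ev]])
    fix p :: "nat \<times> nat" assume p: "True \<and> X \<le> Re (c + of_nat (snd p))"
    obtain k m where km: "p = (k, m)" by fastforce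
    have le: "norm (pochhammer (of_real X :: complex) k) \<le> norm (pochhammer (c + of_nat m) k)"
      unfolding pochhammer_prod prod_norm[symmetric]
    proof (intro prod_mono conjI)
      fix i assume "i \<in> {0..<k}"
      have "norm (of_real X + of_nat i :: complex) = X + real i"
        using X by (metis norm_of_real of_real_add of_real_of_nat_eq abs_of_nonneg add_nonneg_nonneg less_imp_le of_nat_0_le_iff)
      also have "\<dots> \<le> Re (c + of_nat m + of_nat i)" using p km by simp
      also have "\<dots> \<le> norm (c + of_nat m + of_nat i)" by (rule complex_Re_le_cmod)
      finally show "norm (of_real X + of_nat i :: complex) \<le> norm (c + of_nat m + of_nat i)" .
    qed auto
    have "norm (pochhammer (of_real X :: complex) k) > 0"
      using X by (auto simp: pochhammer_neq_0 Re_pos_not_nonpos_Int)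
    thus "norm (hyp_coeff a b (c + of_nat (snd p)) (fst p)) \<le> M (fst p)" using le
      unfolding M_def hyp_coeff_def norm_divide norm_mult km fst_conv snd_conv
      by (intro divide_left_mono mult_right_mono mult_pos_pos) auto
  qed
  have "summable M" unfolding M_def
    using X by (intro summable_norm_hyp_coeff Re_pos_not_nonpos_Int) auto
  from tannerys_theorem[OF lim bound this] have
    "(\<lambda>m. \<Sum>k. hyp_coeff a b (c + of_nat m) k) \<longlonglongrightarrow> (\<Sum>k. if k = 0 then 1 else 0)" by simp
  also have "(\<Sum>k::nat. if k = 0 then 1 else 0 :: complex) = 1"
    using sums_unique[OF sums_single[of 0 "\<lambda>_. 1::complex"]] by simp
  finally show ?thesis .
qed

text \<open>The powers of m in the \<open>rGamma_series\<close> at c and \<open>c - a - b\<close>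
  multiply to the same product as those at \<open>c - a\<close> and \<open>c - b\<close>. The
  iterated contiguity relation is therefore an identity between these series, in which m tends to
  infinity while the shifted sum tends to 1.\<close>

theorem Gauss_hypergeometric_sum:
  assumes c: "c \<notin> \<int>\<^sub>\<le>\<^sub>0" and abc: "0 < Re (c - a - b)"
  shows "hyp_coeff a b c sums (Gamma c * Gamma (c - a - b) * rGamma (c - a) * rGamma (c - b))"
proof -
  define S where "S = (\<Sum>n. hyp_coeff a b c n)"
  have "(\<lambda>m. rGamma_series c m * rGamma_series (c - a - b) m * S) \<longlonglongrightarrow> rGamma c * rGamma (c - a - b) * S"
    by (intro tendsto_intros rGamma_series_LIMSEQ)
  moreover have "(\<lambda>m. rGamma_series (c - a) m * rGamma_series (c - b) m * (\<Sum>n. hyp_coeff a b (c + of_nat (Suc m)) n))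
      \<longlonglongrightarrow> rGamma (c - a) * rGamma (c - b) * 1"
    by (intro tendsto_intros rGamma_series_LIMSEQ LIMSEQ_Suc[OF hyp_coeff_sum_tendsto_1])
  moreover have "rGamma_series c m * rGamma_series (c - a - b) m * S =
     rGamma_series (c - a) m * rGamma_series (c - b) m * (\<Sum>n. hyp_coeff a b (c + of_nat (Suc m)) n)" for m
  proof -
    let ?l = "of_real (ln (real m)) :: complex"
    have e: "exp (c * ?l) * exp ((c - a - b) * ?l) = exp ((c - a) * ?l) * exp ((c - b) * ?l)"
      by (simp flip: exp_add add: algebra_simps)
    have "rGamma_series c m * rGamma_series (c - a - b) m * S =
       pochhammer c (Suc m) * pochhammer (c - a - b) (Suc m) * S / (fact m * fact m * (exp (c * ?l) * exp ((c - a - b) * ?l)))"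
      by (simp add: rGamma_series_def)
    also have "\<dots> = pochhammer (c - a) (Suc m) * pochhammer (c - b) (Suc m) * (\<Sum>n. hyp_coeff a b (c + of_nat (Suc m)) n) /
          (fact m * fact m * (exp ((c - a) * ?l) * exp ((c - b) * ?l)))"
      unfolding S_def e Gauss_contiguity_iterated[OF assms] ..
    finally show ?thesis by (simp add: rGamma_series_def)
  qed
  ultimately have "rGamma c * rGamma (c - a - b) * S = rGamma (c - a) * rGamma (c - b)"
    using LIMSEQ_unique by fastforce
  moreover have "Gamma c * rGamma c = 1" "Gamma (c - a - b) * rGamma (c - a - b) = 1"
    using c Re_pos_not_nonpos_Int[OF abc] by (auto simp: Gamma_def rGamma_eq_zero_iff)
  ultimately have "S = Gamma c * Gamma (c - a - b) * rGamma (c - a) * rGamma (c - b)"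
    by algebra
  moreover have "hyp_coeff a b c sums S" unfolding S_def
    using summable_norm_cancel[OF summable_norm_hyp_coeff[OF assms]] by (rule summable_sums)
  ultimately show ?thesis by simp
qed

section \<open>Beta integrals and moments of hypergeometric weights\<close>

lemma fps_nth_hypergeo_2_1: "fps_nth (fps_hypergeo [a, b] [c] 1) n = hyp_coeff a b c n"
  by (simp add: hyp_coeff_def)

text \<open>The coefficients grow at most polynomially, and a polynomial factor is absorbed by the
  geometric decay of \<open>norm z ^ n\<close>.\<close>

lemma summable_norm_hypergeo_series:
  assumes "c \<notin> \<int>\<^sub>\<le>\<^sub>0" "norm z < 1"
  shows "summable (\<lambda>n. norm (hyp_coeff a b c n * z ^ n))"
proof (cases "z = 0")
  case False
  define r where "r = norm z"
  have r: "0 < r" "r < 1" using assms False by (auto simp: r_def)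
  obtain K where K: "K > 0" "\<And>n. norm (hyp_coeff a b c n) \<le> K * real (Suc n) powr (Re (a + b - c) - 1)"
    using hyp_coeff_bound[OF assms(1), of a b] by blast
  have "(\<lambda>n. real (Suc n) powr p * r ^ n) \<in> O(\<lambda>n. real n powr (-2))" for p
    using r by real_asymp
  hence "summable (\<lambda>n. real (Suc n) powr p * r ^ n)" for p
    by (rule summable_comparison_test_bigo[rotated]) (simp add: summable_real_powr_iff)
  hence "summable (\<lambda>n. K * (real (Suc n) powr (Re (a + b - c) - 1) * r ^ n))"
    by (intro summable_mult)
  thus ?thesis
    using K by (rule_tac summable_comparison_test')
      (auto simp: norm_mult norm_power r_def mult.assoc[symmetric] intro!: mult_right_mono)
next
  case True
  show ?thesis by (rule summable_finite[of "{0}"]) (use True in auto)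
qed

lemma hypergeo_series_sums:
  assumes "c \<notin> \<int>\<^sub>\<le>\<^sub>0" "norm z < 1"
  shows "(\<lambda>n. hyp_coeff a b c n * z ^ n) sums eval_fps (fps_hypergeo [a, b] [c] 1) z"
  using summable_sums[OF summable_norm_cancel[OF summable_norm_hypergeo_series[OF assms]]]
  by (simp add: eval_fps_hypergeo_2_1 hyp_coeff_def)

lemma binomial_series_pochhammer:
  fixes s z :: complex
  assumes "norm z < 1"
  shows "(\<lambda>n. pochhammer s n / fact n * z ^ n) sums (1 - z) powr (- s)"
    and "summable (\<lambda>n. norm (pochhammer s n / fact n * z ^ n))"
proof -
  have "((- s) gchoose n) * (- z) ^ n = pochhammer s n / fact n * z ^ n" for n
    by (simp add: gbinomial_pochhammer power_minus[of z])
  thus "(\<lambda>n. pochhammer s n / fact n * z ^ n) sums (1 - z) powr (- s)"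
    using gen_binomial_complex[of "- z" "- s"] assms by simp
  \<comment> \<open>Absolute convergence is read off from the hypergeometric series, the binomial
    series being \<open>F(s, 1; 1; z)\<close>.\<close>
  have "hyp_coeff s 1 1 n = pochhammer s n / fact n" for n
    by (simp add: hyp_coeff_def pochhammer_fact[symmetric])
  thus "summable (\<lambda>n. norm (pochhammer s n / fact n * z ^ n))"
    using summable_norm_hypergeo_series[OF _ assms, of 1 s 1] by simp
qed

section \<open>Termwise integration and the complex Beta integral\<close>

lemma norm_of_real_powr: "0 < t \<Longrightarrow> norm (of_real t powr z :: complex) = t powr Re z"
  by (simp add: norm_powr_real_powr)

lemma set_integral_sums:
  fixes f :: "nat \<Rightarrow> 'b \<Rightarrow> 'a::{banach, second_countable_topology}"
  assumes int: "\<And>n. set_integrable M A (f n)"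
    and summ: "\<And>x. x \<in> A \<Longrightarrow> summable (\<lambda>n. norm (f n x))"
    and sums: "\<And>x. x \<in> A \<Longrightarrow> (\<lambda>n. f n x) sums g x"
    and summ_int: "summable (\<lambda>n. LINT x:A|M. norm (f n x))"
  shows "set_integrable M A g"
    and "(\<lambda>n. LINT x:A|M. f n x) sums (LINT x:A|M. g x)"
proof -
  let ?f = "\<lambda>n x. indicat_real A x *\<^sub>R f n x"
  have eq: "(\<Sum>n. ?f n x) = indicat_real A x *\<^sub>R g x" for x
    using sums_unique[OF sums] by (cases "x \<in> A") auto
  have s: "summable (\<lambda>n. norm (?f n x))" for x
    using summ by (cases "x \<in> A") auto
  have si: "summable (\<lambda>n. \<integral>x. norm (?f n x) \<partial>M)"
    using summ_int by (simp add: set_lebesgue_integral_def)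
  have i: "integrable M (?f n)" for n using int by (simp add: set_integrable_def)
  show "set_integrable M A g"
    using integrable_suminf[OF i _ si] s unfolding set_integrable_def eq by simp
  show "(\<lambda>n. LINT x:A|M. f n x) sums (LINT x:A|M. g x)"
    using sums_integral[OF i _ si] s unfolding set_lebesgue_integral_def eq by simp
qed

lemma Beta_integral_real:
  assumes "a > 0" "b > (0::real)"
  shows "set_integrable lborel {0<..<1} (\<lambda>t. t powr (a - 1) * (1 - t) powr (b - 1))"
    and "(LBINT t:{0<..<1}. t powr (a - 1) * (1 - t) powr (b - 1)) = Beta a b"
proof -
  show i: "set_integrable lborel {0<..<1} (\<lambda>t. t powr (a - 1) * (1 - t) powr (b - 1))"
    by (rule set_integrable_subset[OF integrable_Beta[OF assms]]) auto
  have "((\<lambda>t. t powr (a - 1) * (1 - t) powr (b - 1)) has_integral Beta a b) {0<..<1}"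
    using has_integral_Beta_real[OF assms] by (simp add: has_integral_Icc_iff_Ioo)
  thus "(LBINT t:{0<..<1}. t powr (a - 1) * (1 - t) powr (b - 1)) = Beta a b"
    using set_borel_integral_eq_integral(2)[OF i] by (simp add: integral_unique)
qed

lemma set_integrable_Beta_complex:
  assumes "0 < Re a" "0 < Re b"
  shows "set_integrable lborel {0<..<1} (\<lambda>t. of_real t powr (a - 1) * of_real (1 - t) powr (b - 1) :: complex)"
proof (rule set_integrable_bound[OF Beta_integral_real(1)[OF assms]])
  have "continuous_on {0<..<1} (\<lambda>t::real. of_real t powr (a - 1) * of_real (1 - t) powr (b - 1) :: complex)"
    by (intro continuous_intros) (auto simp: complex_nonpos_Reals_iff)
  thus "set_borel_measurable lborel {0<..<1} (\<lambda>t. of_real t powr (a - 1) * of_real (1 - t) powr (b - 1) :: complex)"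
    using borel_measurable_continuous_on_indicator by (simp add: set_borel_measurable_def)
  show "AE t in lborel. t \<in> {0<..<1} \<longrightarrow> norm (of_real t powr (a - 1) * of_real (1 - t) powr (b - 1) :: complex)
         \<le> norm (t powr (Re a - 1) * (1 - t) powr (Re b - 1))"
    by (intro always_eventually allI impI)
       (auto simp: norm_mult norm_of_real_powr simp del: of_real_diff)
qed

text \<open>The case \<open>b = 1\<close> of the Beta integral, with the primitive
  \<open>t powr z / z\<close>. It starts the general case, which is reduced to a series of such
  integrals.\<close>

lemma power_integral_complex:
  assumes "0 < Re z"
  shows "set_integrable lborel {0<..<1} (\<lambda>t. of_real t powr (z - 1) :: complex)"
    and "(LBINT t:{0<..<1}. of_real t powr (z - 1) :: complex) = 1 / z"
proof -
  have "set_integrable lborel {0<..<1} (\<lambda>t. of_real t powr (z - 1) * of_real (1 - t) powr (1 - 1) :: complex)"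
    using set_integrable_Beta_complex[of z 1] assms by simp
  also have "?this \<longleftrightarrow> set_integrable lborel {0<..<1} (\<lambda>t. of_real t powr (z - 1) :: complex)"
    by (intro set_integrable_cong) (auto simp del: of_real_diff)
  finally show i: "set_integrable lborel {0<..<1} (\<lambda>t. of_real t powr (z - 1) :: complex)" .
  have z: "z \<noteq> 0" using assms by auto
  have "((\<lambda>t. of_real t powr (z - 1)) has_integral (of_real 1 powr z / z - of_real 0 powr z / z)) {0..1::real}"
  proof (rule fundamental_theorem_of_calculus_interior)
    show "continuous_on {0..1} (\<lambda>t::real. of_real t powr z / z)"
    proof (rule continuous_on_divide)
      show "continuous_on {0..1} (\<lambda>t::real. of_real t powr z)"
        unfolding continuous_on_eq_continuous_within
      proof
        fix x :: real assume x: "x \<in> {0..1}"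
        show "continuous (at x within {0..1}) (\<lambda>t::real. of_real t powr z)"
        proof (cases "x = 0")
          case True
          \<comment> \<open>At the left end \<open>0 powr z\<close> has the value 0 by convention;
            it is the limit as well because \<open>Re z\<close> is positive.\<close>
          have "((\<lambda>t::real. of_real t powr z) \<longlongrightarrow> 0) (at 0 within {0..1})"
          proof (rule Lim_null_comparison)
            show "\<forall>\<^sub>F t in at (0::real) within {0..1}. norm (of_real t powr z :: complex) \<le> t powr Re z"
              by (auto simp: eventually_at_filter norm_of_real_powr)
            show "((\<lambda>t::real. t powr Re z) \<longlongrightarrow> 0) (at 0 within {0..1})"
              using assms by (auto intro!: tendsto_eq_intros simp: eventually_at_filter)
          qed
          thus ?thesis using True by (simp add: continuous_within)
        next
          case False
          with x have "isCont (\<lambda>t::real. of_real t powr z) x"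
            by (intro continuous_intros) (auto simp: complex_nonpos_Reals_iff)
          thus ?thesis by (rule continuous_at_imp_continuous_at_within)
        qed
      qed
    qed (use z in auto)
    show "((\<lambda>t::real. of_real t powr z / z) has_vector_derivative of_real t powr (z - 1)) (at t)"
      if "t \<in> {0<..<1}" for t
    proof -
      have "((\<lambda>w. w powr z / z) has_field_derivative of_real t powr (z - 1)) (at (of_real t))"
        using that z by (auto intro!: derivative_eq_intros simp: complex_nonpos_Reals_iff)
      from has_vector_derivative_real_field[OF this] show ?thesis .
    qed
  qed auto
  hence "((\<lambda>t. of_real t powr (z - 1)) has_integral 1 / z) {0<..<1::real}"
    by (simp add: has_integral_Icc_iff_Ioo)
  thus "(LBINT t:{0<..<1}. of_real t powr (z - 1) :: complex) = 1 / z"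
    using set_borel_integral_eq_integral(2)[OF i] by (simp add: integral_unique)
qed

lemma power_integral_norm:
  assumes "0 < Re z"
  shows "(LBINT t:{0<..<1}. norm (of_real t powr (z - 1) :: complex)) = 1 / Re z"
proof -
  have "(LBINT t:{0<..<1}. norm (of_real t powr (z - 1) :: complex)) =
        (LBINT t:{0<..<1}. t powr (Re z - 1) * (1 - t) powr (1 - 1))"
    by (intro set_lebesgue_integral_cong) (auto simp: norm_of_real_powr)
  also have "\<dots> = 1 / Re z"
  proof -
    have "Re z \<notin> \<int>\<^sub>\<le>\<^sub>0" using assms by (auto elim!: nonpos_Ints_cases)
    thus ?thesis using assms less_imp_neq[OF Gamma_real_pos[OF assms]] Gamma_plus1[of "Re z"]
      by (subst Beta_integral_real) (auto simp: Beta_def)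
  qed
  finally show ?thesis .
qed

text \<open>For consecutive parameters the quotient of Pochhammer symbols collapses to
  \<open>a / (a + n)\<close>, which up to the factor a is the integral of
  \<open>t powr (a + n - 1)\<close>. This is how the series of power integrals becomes a Gauss
  sum.\<close>

lemma hyp_coeff_consecutive:
  assumes "a \<notin> \<int>\<^sub>\<le>\<^sub>0"
  shows "hyp_coeff s a (a + 1) n = pochhammer s n / fact n * (a / (a + of_nat n))"
proof -
  have a: "a \<noteq> 0" "a + of_nat n \<noteq> 0"
    using not_nonpos_Int_add_of_nat[OF assms, of n] assms by auto
  have "pochhammer (a + 1) n = (a + of_nat n) * pochhammer a n / a"
    using a pochhammer_plus1[of a n] by (auto simp: eq_divide_eq mult.commute)
  thus ?thesis using a pochhammer_neq_0[OF assms, of n] by (simp add: hyp_coeff_def)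
qed

text \<open>Expanding \<open>(1 - t)\<^sup>b\<^sup>-\<^sup>1\<close> turns the integral into the Gauss sum \<open>F(1 - b, a; a + 1; 1) / a\<close>.\<close>

theorem Beta_integral_complex:
  assumes a: "0 < Re a" and b: "0 < Re b"
  shows "(LBINT t:{0<..<1}. of_real t powr (a - 1) * of_real (1 - t) powr (b - 1) :: complex) = Beta a b"
proof -
  let ?f = "\<lambda>n t. pochhammer (1 - b) n / fact n * of_real t powr (a + of_nat n - 1) :: complex"
  have an: "0 < Re (a + of_nat n)" for n using a by simp
  have a': "a \<notin> \<int>\<^sub>\<le>\<^sub>0" using Re_pos_not_nonpos_Int[OF a] .
  have pw: "of_real t powr (a + of_nat n - 1) = of_real t powr (a - 1) * (of_real t :: complex) ^ n"
    if "t \<in> {0<..<1::real}" for n t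
    using that by (simp add: diff_add_eq[symmetric] powr_add powr_nat')
  have int: "set_integrable lborel {0<..<1} (?f n)" for n
    by (intro set_integrable_mult_right power_integral_complex an)
  have "(\<lambda>n. LBINT t:{0<..<1}. ?f n t) sums
        (LBINT t:{0<..<1}. of_real t powr (a - 1) * of_real (1 - t) powr (b - 1))"
  proof (rule set_integral_sums(2)[OF int])
    fix t :: real assume t: "t \<in> {0<..<1}"
    have 1: "?f n t = of_real t powr (a - 1) * (pochhammer (1 - b) n / fact n * of_real t ^ n)" for n
      using pw[OF t, of n] by simp
    show "summable (\<lambda>n. norm (?f n t))"
      unfolding 1 norm_mult[of "of_real t powr (a - 1)"] using t
      by (intro summable_mult binomial_series_pochhammer(2)) auto
    show "(\<lambda>n. ?f n t) sums (of_real t powr (a - 1) * of_real (1 - t) powr (b - 1))"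
      unfolding 1 using t binomial_series_pochhammer(1)[of "of_real t" "1 - b"]
      by (intro sums_mult) auto
  next
    have Ra: "of_real (Re a) \<notin> (\<int>\<^sub>\<le>\<^sub>0 :: complex set)" using a by (intro Re_pos_not_nonpos_Int) auto
    \<comment> \<open>In norm the power integral is \<open>1 / (Re a + n)\<close>, so the same
      coefficients appear with a replaced by its real part. For them the excess that decides
      summability is b.\<close>
    have "(LBINT t:{0<..<1}. norm (?f n t)) = norm (hyp_coeff (1 - b) (of_real (Re a)) (of_real (Re a) + 1) n) / Re a" for n
    proof -
      have "(LBINT t:{0<..<1}. norm (?f n t)) = norm (pochhammer (1 - b) n / fact n) * (1 / (Re a + real n))"
        unfolding norm_mult using power_integral_norm[OF an[of n]]
        by (subst set_integral_mult_right) simp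
      moreover have "norm (of_real (Re a) + of_nat n :: complex) = Re a + real n"
        using a by (metis norm_of_real of_real_add of_real_of_nat_eq abs_of_nonneg add_nonneg_nonneg less_imp_le of_nat_0_le_iff)
      ultimately show ?thesis using a
        unfolding hyp_coeff_consecutive[OF Ra] norm_mult norm_divide by simp
    qed
    moreover have "summable (\<lambda>n. norm (hyp_coeff (1 - b) (of_real (Re a)) (of_real (Re a) + 1) n) / Re a)"
      using a b by (intro summable_divide summable_norm_hyp_coeff Re_pos_not_nonpos_Int) auto
    ultimately show "summable (\<lambda>n. LBINT t:{0<..<1}. norm (?f n t))" by simp
  qed
  moreover have "(LBINT t:{0<..<1}. ?f n t) = hyp_coeff (1 - b) a (a + 1) n / a" for n
    using power_integral_complex(2)[OF an[of n]] a' 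
    by (subst set_integral_mult_right) (auto simp: hyp_coeff_consecutive)
  ultimately have "(\<lambda>n. hyp_coeff (1 - b) a (a + 1) n / a) sums
     (LBINT t:{0<..<1}. of_real t powr (a - 1) * of_real (1 - t) powr (b - 1))" by simp
  moreover have "(\<lambda>n. hyp_coeff (1 - b) a (a + 1) n / a) sums
      (Gamma (a + 1) * Gamma (a + 1 - (1 - b) - a) * rGamma (a + 1 - (1 - b)) * rGamma (a + 1 - a) / a)"
    using a b by (intro sums_divide Gauss_hypergeometric_sum Re_pos_not_nonpos_Int) auto
  ultimately have "(LBINT t:{0<..<1}. of_real t powr (a - 1) * of_real (1 - t) powr (b - 1)) =
      Gamma (a + 1) * Gamma (a + 1 - (1 - b) - a) * rGamma (a + 1 - (1 - b)) * rGamma (a + 1 - a) / a"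
    by (rule sums_unique2)
  thus ?thesis using a' by (auto simp: Gamma_plus1 Beta_altdef)
qed

section \<open>Moments of hypergeometric weights\<close>

lemma Gamma_add_of_nat: "z \<notin> \<int>\<^sub>\<le>\<^sub>0 \<Longrightarrow> Gamma (z + of_nat n) = pochhammer z n * (Gamma z :: complex)"
  using pochhammer_Gamma[of z n] by (simp add: Gamma_eq_zero_iff)

lemma rGamma_add_of_nat: "z \<notin> \<int>\<^sub>\<le>\<^sub>0 \<Longrightarrow> rGamma (z + of_nat n) = rGamma (z::complex) / pochhammer z n"
  using pochhammer_rGamma[of z n] pochhammer_neq_0[of z n] by (simp add: eq_divide_eq)

lemma Beta_add_of_nat_left:
  fixes a b :: complex
  assumes "a \<notin> \<int>\<^sub>\<le>\<^sub>0" "a + b \<notin> \<int>\<^sub>\<le>\<^sub>0"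
  shows "Beta (a + of_nat n) b = Beta a b * (pochhammer a n / pochhammer (a + b) n)"
  using Gamma_add_of_nat[OF assms(1), of n] rGamma_add_of_nat[OF assms(2), of n]
  by (simp add: Beta_altdef add_ac)

text \<open>Integrated termwise, the n-th coefficient acquires the factor
  \<open>Beta (C + n) s\<close>, which replaces the lower parameter C by \<open>C + s\<close>. The
  result is \<open>Beta C s\<close> times the Gauss sum \<open>F(A, B; C + s; 1)\<close>, and
  \<open>Gamma (C + s)\<close> cancels.\<close>

theorem hypergeo_moment:
  assumes C: "0 < Re C" and s: "0 < Re s" and CsAB: "0 < Re (C + s - A - B)"
  defines "g \<equiv> (\<lambda>t. of_real t powr (C - 1) * of_real (1 - t) powr (s - 1) *
                    eval_fps (fps_hypergeo [A, B] [C] 1) (of_real t))"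
  shows "set_integrable lborel {0<..<1} g"
    and "(LBINT t:{0<..<1}. g t) =
           Gamma C * Gamma s * Gamma (C + s - A - B) * rGamma (C + s - A) * rGamma (C + s - B)"
proof -
  let ?f = "\<lambda>n t. hyp_coeff A B C n * (of_real t powr (C + of_nat n - 1) * of_real (1 - t) powr (s - 1)) :: complex"
  have Cn: "0 < Re (C + of_nat n)" for n using C by simp
  have C': "C \<notin> \<int>\<^sub>\<le>\<^sub>0" and Cs': "C + s \<notin> \<int>\<^sub>\<le>\<^sub>0" using C s by (auto intro!: Re_pos_not_nonpos_Int)
  have int: "set_integrable lborel {0<..<1} (?f n)" for n
    by (intro set_integrable_mult_right set_integrable_Beta_complex Cn s)
  have pw: "of_real t powr (C + of_nat n - 1) = of_real t powr (C - 1) * (of_real t :: complex) ^ n"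
    if "t \<in> {0<..<1::real}" for n t
    using that by (simp add: diff_add_eq[symmetric] powr_add powr_nat')
  have summ: "summable (\<lambda>n. norm (?f n t))" and sums: "(\<lambda>n. ?f n t) sums g t" if t: "t \<in> {0<..<1}" for t
  proof -
    have 1: "?f n t = of_real t powr (C - 1) * of_real (1 - t) powr (s - 1) * (hyp_coeff A B C n * of_real t ^ n)" for n
      using pw[OF t, of n] by simp
    show "summable (\<lambda>n. norm (?f n t))"
      unfolding 1 norm_mult[of "of_real t powr (C - 1) * of_real (1 - t) powr (s - 1)"] using t C'
      by (intro summable_mult summable_norm_hypergeo_series) auto
    show "(\<lambda>n. ?f n t) sums g t"
      unfolding 1 g_def using t C' by (intro sums_mult hypergeo_series_sums) auto
  qed
  have summ_int: "summable (\<lambda>n. LBINT t:{0<..<1}. norm (?f n t))"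
  proof -
    let ?C = "of_real (Re C) :: complex" and ?s = "of_real (Re s) :: complex"
    have CC: "?C \<notin> \<int>\<^sub>\<le>\<^sub>0" "?C + ?s \<notin> \<int>\<^sub>\<le>\<^sub>0" using C s by (auto intro!: Re_pos_not_nonpos_Int)
    \<comment> \<open>The absolute integrals involve real Beta values; their dependence on n is that
      of \<open>hyp_coeff\<close> with parameters \<open>Re C\<close>, 1 and
      \<open>Re C + Re s\<close>, so that \<open>hyp_coeff_bound\<close> also controls them.\<close>
    have eq: "(LBINT t:{0<..<1}. norm (?f n t)) =
       norm (Beta ?C ?s) * (norm (hyp_coeff A B C n) * norm (hyp_coeff ?C 1 (?C + ?s) n))" for n
    proof -
      have "(LBINT t:{0<..<1}. norm (?f n t)) = (LBINT t:{0<..<1}. norm (hyp_coeff A B C n) *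
          (t powr (Re (C + of_nat n) - 1) * (1 - t) powr (Re s - 1)))"
        by (intro set_lebesgue_integral_cong) (auto simp: norm_mult norm_of_real_powr simp del: of_real_diff)
      also have "\<dots> = norm (hyp_coeff A B C n) * Beta (Re (C + of_nat n)) (Re s)"
        using Beta_integral_real(2)[OF Cn[of n] s] by (subst set_integral_mult_right) simp
      also have "Beta (Re (C + of_nat n)) (Re s) = norm (complex_of_real (Beta (Re (C + of_nat n)) (Re s)))"
        unfolding norm_of_real using s Cn[of n]
        by (intro abs_of_pos[symmetric]) (simp add: Beta_def Gamma_real_pos)
      also have "complex_of_real (Beta (Re (C + of_nat n)) (Re s)) = Beta (?C + of_nat n) ?s"
        by (simp flip: Beta_complex_of_real)
      also have "\<dots> = Beta ?C ?s * hyp_coeff ?C 1 (?C + ?s) n"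
        by (subst Beta_add_of_nat_left[OF CC]) (simp add: hyp_coeff_def pochhammer_fact[symmetric])
      finally show ?thesis by (simp add: norm_mult)
    qed
    obtain K where K: "K > 0" "\<And>n. norm (hyp_coeff A B C n) \<le> K * real (Suc n) powr (Re (A + B - C) - 1)"
      using hyp_coeff_bound[OF C', of A B] by blast
    obtain L where L: "L > 0" "\<And>n. norm (hyp_coeff ?C 1 (?C + ?s) n) \<le> L * real (Suc n) powr (Re (?C + 1 - (?C + ?s)) - 1)"
      using hyp_coeff_bound[OF CC(2), of ?C 1] by blast
    \<comment> \<open>The two growth exponents are \<open>Re (A + B - C) - 1\<close> and
      \<open>- Re s\<close>; their sum is below -1 exactly because \<open>Re (C + s - A - B)\<close>
      is positive.\<close>
    have s1: "summable (\<lambda>n. norm (Beta ?C ?s) * (K * L * real (Suc n) powr (Re (A + B - C - s) - 1)))"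
      using CsAB by (intro summable_mult summable_Suc_powr) simp
    have s2: "norm (norm (Beta ?C ?s) * (norm (hyp_coeff A B C n) * norm (hyp_coeff ?C 1 (?C + ?s) n))) \<le>
       norm (Beta ?C ?s) * (K * L * real (Suc n) powr (Re (A + B - C - s) - 1))" for n
    proof -
      have "norm (hyp_coeff A B C n) * norm (hyp_coeff ?C 1 (?C + ?s) n) \<le>
         (K * real (Suc n) powr (Re (A + B - C) - 1)) * (L * real (Suc n) powr (Re (?C + 1 - (?C + ?s)) - 1))"
        using K L by (intro mult_mono) auto
      also have "\<dots> = K * L * (real (Suc n) powr (Re (A + B - C) - 1) * real (Suc n) powr (- Re s))"
        by simp
      also have "\<dots> = K * L * real (Suc n) powr (Re (A + B - C - s) - 1)"
        by (subst powr_add[symmetric]) (simp add: algebra_simps)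
      finally show ?thesis by (auto intro!: mult_left_mono)
    qed
    show ?thesis unfolding eq by (rule summable_comparison_test'[OF s1, of 0]) (rule s2)
  qed
  show "set_integrable lborel {0<..<1} g"
    by (rule set_integral_sums(1)[OF int summ sums summ_int])
  have "(\<lambda>n. LBINT t:{0<..<1}. ?f n t) sums (LBINT t:{0<..<1}. g t)"
    by (rule set_integral_sums(2)[OF int summ sums summ_int])
  moreover have "(LBINT t:{0<..<1}. ?f n t) = Beta C s * hyp_coeff A B (C + s) n" for n
  proof -
    have "(LBINT t:{0<..<1}. ?f n t) = hyp_coeff A B C n * Beta (C + of_nat n) s"
      using Beta_integral_complex[OF Cn[of n] s] by (subst set_integral_mult_right) simp
    also have "\<dots> = Beta C s * hyp_coeff A B (C + s) n"
      using pochhammer_neq_0[OF C', of n] by (subst Beta_add_of_nat_left[OF C' Cs']) (simp add: hyp_coeff_def mult_ac)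
    finally show ?thesis .
  qed
  ultimately have "(\<lambda>n. Beta C s * hyp_coeff A B (C + s) n) sums (LBINT t:{0<..<1}. g t)" by simp
  moreover have "(\<lambda>n. Beta C s * hyp_coeff A B (C + s) n) sums
     (Beta C s * (Gamma (C + s) * Gamma (C + s - A - B) * rGamma (C + s - A) * rGamma (C + s - B)))"
    by (intro sums_mult Gauss_hypergeometric_sum Cs' CsAB)
  ultimately have "(LBINT t:{0<..<1}. g t) =
     Beta C s * (Gamma (C + s) * Gamma (C + s - A - B) * rGamma (C + s - A) * rGamma (C + s - B))"
    by (rule sums_unique2)
  thus "(LBINT t:{0<..<1}. g t) =
           Gamma C * Gamma s * Gamma (C + s - A - B) * rGamma (C + s - A) * rGamma (C + s - B)"
    using Cs' by (simp add: Beta_def Gamma_eq_zero_iff)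
qed

section \<open>Integral transforms with kernel \<open>(1 - u t)\<^sup>-\<^sup>\<sigma>\<close>\<close>

text \<open>Differentiation under the integral sign. An integrable majorant of the functions
  themselves suffices, since Cauchy's inequality turns it into a majorant of the difference
  quotients.\<close>

lemma holomorphic_on_set_integral:
  fixes f :: "complex \<Rightarrow> 'b \<Rightarrow> complex"
  assumes S: "open S"
    and hol: "\<And>t. t \<in> A \<Longrightarrow> (\<lambda>u. f u t) holomorphic_on S"
    and int: "\<And>u. u \<in> S \<Longrightarrow> set_integrable M A (f u)"
    and dom: "\<And>u. u \<in> S \<Longrightarrow> \<exists>r>0. \<exists>h. cball u r \<subseteq> S \<and> set_integrable M A h \<and>
                 (\<forall>w\<in>cball u r. \<forall>t\<in>A. norm (f w t) \<le> (h t :: real))"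
  shows "(\<lambda>u. LINT t:A|M. f u t) holomorphic_on S"
  unfolding holomorphic_on_open[OF S]
proof
  fix u assume u: "u \<in> S"
  let ?F = "\<lambda>u. LINT t:A|M. f u t"
  obtain r h where r: "r > 0" "cball u r \<subseteq> S" and h: "set_integrable M A h"
    and fh: "\<And>w t. w \<in> cball u r \<Longrightarrow> t \<in> A \<Longrightarrow> norm (f w t) \<le> h t"
    using dom[OF u] by blast
  \<comment> \<open>Every point of the ball of radius \<open>r/2\<close> is the centre of a disc of
    radius \<open>r/2\<close> inside \<open>cball u r\<close>. Cauchy's inequality there bounds the
    derivative by \<open>2 * h t / r\<close>.\<close>
  have lip: "norm (f w t - f u t) \<le> 2 * h t / r * norm (w - u)" if w: "w \<in> ball u (r/2)" and t: "t \<in> A" for w t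
  proof (rule field_differentiable_bound[where S = "ball u (r/2)" and f' = "deriv (\<lambda>u. f u t)"])
    fix v assume v: "v \<in> ball u (r/2)"
    have sub: "cball v (r/2) \<subseteq> cball u r"
    proof
      fix z assume "z \<in> cball v (r/2)"
      with v show "z \<in> cball u r" using dist_triangle[of u z v] by (simp add: dist_commute)
    qed
    have vS: "v \<in> S" using v r by (auto intro!: subsetD[OF r(2)])
    show "((\<lambda>u. f u t) has_field_derivative deriv (\<lambda>u. f u t) v) (at v within ball u (r/2))"
      using holomorphic_derivI[OF hol[OF t] S vS] DERIV_subset by blast
    have "norm ((deriv ^^ 1) (\<lambda>u. f u t) v) \<le> fact 1 * h t / (r/2)^1"
    proof (rule Cauchy_inequality)
      show "(\<lambda>u. f u t) holomorphic_on ball v (r/2)"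
        using sub r(2) ball_subset_cball by (intro holomorphic_on_subset[OF hol[OF t]]) blast
      show "continuous_on (cball v (r/2)) (\<lambda>u. f u t)"
        using sub r(2) by (intro holomorphic_on_imp_continuous_on holomorphic_on_subset[OF hol[OF t]]) auto
      show "norm (f x t) \<le> h t" if "norm (v - x) = r/2" for x
        using that sub by (intro fh t) (auto simp: dist_norm)
    qed (use r in auto)
    thus "norm (deriv (\<lambda>u. f u t) v) \<le> 2 * h t / r" by (simp add: mult.commute)
  qed (use w r in auto)
  have "((\<lambda>w. (?F w - ?F u) / (w - u)) \<longlongrightarrow> (LINT t:A|M. deriv (\<lambda>u. f u t) u)) (at u within ball u (r/2))"
    \<comment> \<open>The limit is taken along sequences, to which dominated convergence
      applies.\<close>
    unfolding tendsto_at_iff_sequentially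
  proof (intro allI impI)
    fix X assume X: "\<forall>i. X i \<in> ball u (r/2) - {u}" and lim: "X \<longlonglongrightarrow> u"
    have XS: "X i \<in> S" for i using X r by (intro subsetD[OF r(2)]) (auto dest!: spec[of _ i])
    let ?g = "\<lambda>i t. indicat_real A t *\<^sub>R ((f (X i) t - f u t) / (X i - u))"
    have gi: "set_integrable M A (\<lambda>t. (f (X i) t - f u t) / (X i - u))" for i
      by (intro set_integrable_divide set_integral_diff int XS u)
    have "(?F (X i) - ?F u) / (X i - u) = (\<integral>t. ?g i t \<partial>M)" for i
      using set_integral_diff[OF int[OF XS[of i]] int[OF u]]
      by (simp add: set_lebesgue_integral_def[symmetric] set_integral_divide_zero)
    moreover have "(\<lambda>i. \<integral>t. ?g i t \<partial>M) \<longlonglongrightarrow> (\<integral>t. indicat_real A t *\<^sub>R deriv (\<lambda>u. f u t) u \<partial>M)"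
    proof (rule integral_dominated_convergence)
      have ptw: "(\<lambda>i. ?g i t) \<longlonglongrightarrow> indicat_real A t *\<^sub>R deriv (\<lambda>u. f u t) u" for t
      proof (cases "t \<in> A")
        case True
        have "((\<lambda>u. f u t) has_field_derivative deriv (\<lambda>u. f u t) u) (at u)"
          using holomorphic_derivI[OF hol[OF True] S u] .
        hence "((\<lambda>w. (f w t - f u t) / (w - u)) \<longlongrightarrow> deriv (\<lambda>u. f u t) u) (at u)"
          by (simp add: has_field_derivative_iff)
        moreover have "filterlim X (at u) sequentially"
          using lim X by (auto simp: filterlim_at)
        ultimately have "(\<lambda>i. (f (X i) t - f u t) / (X i - u)) \<longlonglongrightarrow> deriv (\<lambda>u. f u t) u"
          by (rule filterlim_compose)
        thus ?thesis using True by simp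
      qed auto
      show gm: "?g i \<in> borel_measurable M" for i
        using gi[of i] by (auto simp: set_integrable_def)
      show "(\<lambda>t. indicat_real A t *\<^sub>R deriv (\<lambda>u. f u t) u) \<in> borel_measurable M"
        by (rule borel_measurable_LIMSEQ_metric[OF gm ptw])
      show "integrable M (\<lambda>t. indicat_real A t *\<^sub>R (2 * h t / r))"
        using set_integrable_divide[OF set_integrable_mult_right[OF h, of 2], of r] r
        by (simp add: set_integrable_def)
      show "AE t in M. (\<lambda>i. ?g i t) \<longlonglongrightarrow> indicat_real A t *\<^sub>R deriv (\<lambda>u. f u t) u"
        using ptw by simp
      show "AE t in M. norm (?g i t) \<le> indicat_real A t *\<^sub>R (2 * h t / r)" for i
      proof (intro always_eventually allI)
        fix t show "norm (?g i t) \<le> indicat_real A t *\<^sub>R (2 * h t / r)"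
        proof (cases "t \<in> A")
          case True
          have "X i - u \<noteq> 0" using X by auto
          thus ?thesis using lip[of "X i" t] X True by (auto simp: norm_divide divide_le_eq)
        qed auto
      qed
    qed
    ultimately show "((\<lambda>w. (?F w - ?F u) / (w - u)) \<circ> X) \<longlonglongrightarrow> (LINT t:A|M. deriv (\<lambda>u. f u t) u)"
      by (simp add: o_def set_lebesgue_integral_def)
  qed
  hence "((\<lambda>w. (?F w - ?F u) / (w - u)) \<longlongrightarrow> (LINT t:A|M. deriv (\<lambda>u. f u t) u)) (at u)"
    using r by (simp add: at_within_open[of u "ball u (r/2)"])
  thus "\<exists>f'. (?F has_field_derivative f') (at u)"
    by (auto simp: has_field_derivative_iff)
qed

section \<open>The plane cut along the real numbers from 1 on\<close>

definition cut_plane :: "complex set" where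
  "cut_plane = - complex_of_real ` {1..}"

text \<open>In this form the cut is the preimage of the branch cut of \<open>powr\<close> under
  \<open>1 - z\<close>, so powers of \<open>1 - z\<close> are holomorphic on
  \<open>cut_plane\<close>.\<close>

lemma cut_plane_iff: "z \<in> cut_plane \<longleftrightarrow> 1 - z \<notin> \<real>\<^sub>\<le>\<^sub>0"
proof -
  have "z \<in> complex_of_real ` {1..} \<longleftrightarrow> Im z = 0 \<and> 1 \<le> Re z"
    by (auto simp: complex_eq_iff image_iff intro!: bexI[of _ "Re z"])
  thus ?thesis by (auto simp: cut_plane_def complex_nonpos_Reals_iff)
qed

lemma of_real_in_cut_plane_iff: "complex_of_real x \<in> cut_plane \<longleftrightarrow> x < 1"
  by (auto simp: cut_plane_iff complex_nonpos_Reals_iff)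

lemma open_cut_plane: "open cut_plane"
proof -
  have "cut_plane = (\<lambda>z. 1 - z) -` (- \<real>\<^sub>\<le>\<^sub>0)" by (auto simp: cut_plane_iff)
  moreover have "open ((\<lambda>z::complex. 1 - z) -` (- \<real>\<^sub>\<le>\<^sub>0))"
    by (intro open_vimage continuous_intros) auto
  ultimately show ?thesis by simp
qed

text \<open>The cut plane is star-shaped about 0. This gives connectedness, and it keeps
  \<open>1 - u * t\<close> off the branch cut for every t in the unit interval.\<close>

lemma cut_plane_scale:
  assumes "z \<in> cut_plane" "t \<in> {0..1}"
  shows "z * of_real t \<in> cut_plane"
proof (rule ccontr)
  assume "z * of_real t \<notin> cut_plane"
  hence 1: "Im z * t = 0" "1 \<le> Re z * t" by (auto simp: cut_plane_iff complex_nonpos_Reals_iff)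
  hence t: "t > 0" "Im z = 0" using assms(2) by (auto simp: less_le)
  have "Re z \<ge> 1"
  proof (rule ccontr)
    assume "\<not> Re z \<ge> 1"
    hence "Re z * t < 1 * t" using t by (intro mult_strict_right_mono) auto
    thus False using 1 assms(2) by simp
  qed
  thus False using assms(1) t by (auto simp: cut_plane_iff complex_nonpos_Reals_iff)
qed

lemma connected_cut_plane: "connected cut_plane"
proof -
  have "starlike cut_plane"
    unfolding starlike_def
  proof (intro bexI[of _ 0] ballI subsetI)
    fix x z assume x: "x \<in> cut_plane" and "z \<in> closed_segment 0 x"
    then obtain t where "z = x * of_real t" "t \<in> {0..1}"
      by (auto simp: in_segment scaleR_conv_of_real mult.commute)
    thus "z \<in> cut_plane" using cut_plane_scale[OF x] by simp
  qed (auto simp: cut_plane_iff)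
  thus ?thesis by (rule starlike_imp_connected)
qed

lemma unit_ball_subset_cut_plane: "ball 0 1 \<subseteq> cut_plane"
proof
  fix z :: complex assume "z \<in> ball 0 1"
  hence "Re z < 1" using complex_Re_le_cmod[of z] by simp
  thus "z \<in> cut_plane" by (auto simp: cut_plane_iff complex_nonpos_Reals_iff)
qed

lemma zero_in_cut_plane: "0 \<in> cut_plane"
  using unit_ball_subset_cut_plane by auto

section \<open>The kernel transform: integrability, holomorphy and expansion at 0\<close>

lemma kernel_continuous:
  fixes \<sigma> :: complex
  shows "continuous_on (cut_plane \<times> {0..1}) (\<lambda>(u, t). (1 - u * of_real t) powr (- \<sigma>))"
proof -
  have "Re (1 - fst p * of_real (snd p)) > 0 \<or> Im (1 - fst p * of_real (snd p)) \<noteq> 0"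
    if "p \<in> cut_plane \<times> {0..1}" for p
    using that cut_plane_scale[of "fst p" "snd p"]
    by (auto simp: cut_plane_iff complex_nonpos_Reals_iff)
  thus ?thesis unfolding case_prod_unfold
    by (intro continuous_intros) (force simp: complex_eq_iff)+
qed

text \<open>Joint continuity up to both ends of the t-interval gives a bound on the compact product.
  It yields the majorants for integrability and for holomorphy of the transform.\<close>

lemma kernel_locally_bounded:
  assumes "compact K" "K \<subseteq> cut_plane"
  obtains B where "\<And>u t. u \<in> K \<Longrightarrow> t \<in> {0..1} \<Longrightarrow> norm ((1 - u * of_real t) powr (- \<sigma>) :: complex) \<le> B"
proof -
  have "compact ((\<lambda>(u, t). (1 - u * of_real t) powr (- \<sigma>) :: complex) ` (K \<times> {0..1}))"
    using assms by (intro compact_continuous_image continuous_on_subset[OF kernel_continuous] compact_Times) auto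
  hence "bounded ((\<lambda>(u, t). (1 - u * of_real t) powr (- \<sigma>) :: complex) ` (K \<times> {0..1}))"
    by (rule compact_imp_bounded)
  thus ?thesis by (fastforce simp: bounded_iff intro: that)
qed

lemma set_integrable_kernel:
  fixes G :: "real \<Rightarrow> complex"
  assumes G: "set_integrable lborel {0<..<1} G" and u: "u \<in> cut_plane"
  shows "set_integrable lborel {0<..<1} (\<lambda>t. G t * (1 - u * of_real t) powr (- \<sigma>))"
proof -
  obtain B where B: "\<And>v t. v \<in> {u} \<Longrightarrow> t \<in> {0..1} \<Longrightarrow> norm ((1 - v * of_real t) powr (- \<sigma>) :: complex) \<le> B"
    using kernel_locally_bounded[of "{u}" \<sigma>] u by auto
  show ?thesis
  proof (rule set_integrable_bound)
    show "set_integrable lborel {0<..<1} (\<lambda>t. B * norm (G t))"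
      by (intro set_integrable_mult_right set_integrable_norm G)
    have "continuous_on {0<..<1} (\<lambda>t. (1 - u * of_real t) powr (- \<sigma>))"
      using u by (intro continuous_on_compose2[OF kernel_continuous[of \<sigma>],
        of _ "\<lambda>t. (u, t)", unfolded prod.case]) (auto intro!: continuous_intros)
    hence "(\<lambda>t. indicat_real {0<..<1} t *\<^sub>R (1 - u * of_real t) powr (- \<sigma>)) \<in> borel_measurable lborel"
      using borel_measurable_continuous_on_indicator by simp
    hence "(\<lambda>t. (indicat_real {0<..<1} t *\<^sub>R G t) * (indicat_real {0<..<1} t *\<^sub>R (1 - u * of_real t) powr (- \<sigma>)))
        \<in> borel_measurable lborel"
      using G by (intro borel_measurable_times) (auto simp: set_integrable_def)
    also have "(\<lambda>t. (indicat_real {0<..<1} t *\<^sub>R G t) * (indicat_real {0<..<1} t *\<^sub>R (1 - u * of_real t) powr (- \<sigma>))) =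
       (\<lambda>t. indicat_real {0<..<1} t *\<^sub>R (G t * (1 - u * of_real t) powr (- \<sigma>)))"
      by (auto simp: indicator_def)
    finally show "set_borel_measurable lborel {0<..<1} (\<lambda>t. G t * (1 - u * of_real t) powr (- \<sigma>))"
      by (simp add: set_borel_measurable_def)
    show "AE t in lborel. t \<in> {0<..<1} \<longrightarrow> norm (G t * (1 - u * of_real t) powr (- \<sigma>)) \<le> norm (B * norm (G t))"
    proof (intro always_eventually allI impI)
      fix t :: real assume t: "t \<in> {0<..<1}"
      have "norm ((1 - u * of_real t) powr (- \<sigma>)) \<le> B" using B[of u t] t by auto
      hence "norm (G t) * norm ((1 - u * of_real t) powr (- \<sigma>)) \<le> norm (G t) * \<bar>B\<bar>"
        by (intro mult_left_mono) auto
      thus "norm (G t * (1 - u * of_real t) powr (- \<sigma>)) \<le> norm (B * norm (G t))"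
        by (simp add: norm_mult abs_mult mult.commute)
    qed
  qed
qed

lemma kernel_transform_holomorphic:
  fixes G :: "real \<Rightarrow> complex"
  assumes G: "set_integrable lborel {0<..<1} G"
  shows "(\<lambda>u. LBINT t:{0<..<1}. G t * (1 - u * of_real t) powr (- \<sigma>)) holomorphic_on cut_plane"
proof (rule holomorphic_on_set_integral[OF open_cut_plane])
  show "(\<lambda>u. G t * (1 - u * of_real t) powr (- \<sigma>)) holomorphic_on cut_plane" if "t \<in> {0<..<1}" for t
  proof (intro holomorphic_intros)
    fix u assume "u \<in> cut_plane"
    thus "1 - u * of_real t \<notin> \<real>\<^sub>\<le>\<^sub>0" using cut_plane_scale[of u t] that by (auto simp: cut_plane_iff)
  qed
  show "set_integrable lborel {0<..<1} (\<lambda>t. G t * (1 - u * of_real t) powr (- \<sigma>))" if "u \<in> cut_plane" for u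
    by (rule set_integrable_kernel[OF G that])
  fix u assume u: "u \<in> cut_plane"
  then obtain r where r: "r > 0" "cball u r \<subseteq> cut_plane"
    using open_cut_plane open_contains_cball by blast
  obtain B where B: "\<And>v t. v \<in> cball u r \<Longrightarrow> t \<in> {0..1} \<Longrightarrow> norm ((1 - v * of_real t) powr (- \<sigma>) :: complex) \<le> B"
    using kernel_locally_bounded[OF compact_cball r(2), of \<sigma>] by blast
  have "set_integrable lborel {0<..<1} (\<lambda>t. norm (G t) * B)"
    by (intro set_integrable_mult_left set_integrable_norm G)
  moreover have "norm (G t * (1 - w * of_real t) powr (- \<sigma>)) \<le> norm (G t) * B"
    if "w \<in> cball u r" "t \<in> {0<..<1}" for w t
    unfolding norm_mult using B[of w t] that by (intro mult_left_mono) auto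
  ultimately show "\<exists>r>0. \<exists>h. cball u r \<subseteq> cut_plane \<and> set_integrable lborel {0<..<1} h \<and>
     (\<forall>w\<in>cball u r. \<forall>t\<in>{0<..<1}. norm (G t * (1 - w * of_real t) powr (- \<sigma>)) \<le> h t)"
    using r by blast
qed

lemma set_integrable_moment:
  fixes G :: "real \<Rightarrow> complex"
  assumes G: "set_integrable lborel {0<..<1} G"
  shows "set_integrable lborel {0<..<1} (\<lambda>t. G t * of_real t ^ n)"
proof (rule set_integrable_bound[OF G])
  have "(\<lambda>t. (indicat_real {0<..<1} t *\<^sub>R G t) * of_real t ^ n) \<in> borel_measurable lborel"
    using G by (intro borel_measurable_times) (auto simp: set_integrable_def)
  thus "set_borel_measurable lborel {0<..<1} (\<lambda>t. G t * of_real t ^ n)"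
    by (simp add: set_borel_measurable_def)
  show "AE t in lborel. t \<in> {0<..<1} \<longrightarrow> norm (G t * of_real t ^ n) \<le> norm (G t)"
    by (intro always_eventually) (auto simp: norm_mult norm_power intro!: mult_left_le power_le_one)
qed

text \<open>The binomial series in \<open>u * t\<close> is integrated termwise. Since
  \<open>t ^ n\<close> is at most 1, the integral of \<open>norm (G t)\<close> bounds all moments,
  and the absolute binomial series in u dominates.\<close>

lemma kernel_transform_expansion:
  fixes G :: "real \<Rightarrow> complex"
  assumes G: "set_integrable lborel {0<..<1} G"
  shows "(\<lambda>u. LBINT t:{0<..<1}. G t * (1 - u * of_real t) powr (- \<sigma>)) has_fps_expansion
     Abs_fps (\<lambda>n. pochhammer \<sigma> n / fact n * (LBINT t:{0<..<1}. G t * of_real t ^ n))"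
proof (rule has_fps_expansionI)
  have "eventually (\<lambda>u. u \<in> ball (0::complex) 1) (nhds 0)"
    by (intro eventually_nhds_in_open) auto
  thus "eventually (\<lambda>u. (\<lambda>n. fps_nth (Abs_fps (\<lambda>n. pochhammer \<sigma> n / fact n * (LBINT t:{0<..<1}. G t * of_real t ^ n))) n * u ^ n)
           sums (LBINT t:{0<..<1}. G t * (1 - u * of_real t) powr (- \<sigma>))) (nhds 0)"
  proof eventually_elim
    case (elim u)
    hence u: "norm u < 1" by simp
    let ?f = "\<lambda>n t. (pochhammer \<sigma> n / fact n * u ^ n) * (G t * of_real t ^ n)"
    have "(\<lambda>n. LBINT t:{0<..<1}. ?f n t) sums (LBINT t:{0<..<1}. G t * (1 - u * of_real t) powr (- \<sigma>))"
    proof (rule set_integral_sums(2))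
      show int: "set_integrable lborel {0<..<1} (?f n)" for n
        by (intro set_integrable_mult_right set_integrable_moment G)
      fix t :: real assume t: "t \<in> {0<..<1}"
      have ut: "norm (u * of_real t) < 1"
        using u t mult_strict_mono[of "norm u" 1 t 1] by (simp add: norm_mult)
      have eq: "?f n t = G t * (pochhammer \<sigma> n / fact n * (u * of_real t) ^ n)" for n
        by (simp add: power_mult_distrib)
      show "summable (\<lambda>n. norm (?f n t))"
        unfolding eq norm_mult[of "G t"] by (intro summable_mult binomial_series_pochhammer ut)
      show "(\<lambda>n. ?f n t) sums (G t * (1 - u * of_real t) powr (- \<sigma>))"
        unfolding eq by (intro sums_mult binomial_series_pochhammer ut)
    next
      have le: "norm (LBINT t:{0<..<1}. norm (?f n t)) \<le> norm (pochhammer \<sigma> n / fact n * u ^ n) * (LBINT t:{0<..<1}. norm (G t))" for n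
      proof -
        have "(LBINT t:{0<..<1}. norm (?f n t)) = norm (pochhammer \<sigma> n / fact n * u ^ n) * (LBINT t:{0<..<1}. norm (G t * of_real t ^ n))"
          unfolding norm_mult[of "_ * u ^ n"] by (rule set_integral_mult_right)
        moreover have "(LBINT t:{0<..<1}. norm (G t * of_real t ^ n)) \<le> (LBINT t:{0<..<1}. norm (G t))"
          by (intro set_integral_mono set_integrable_norm set_integrable_moment G)
             (auto simp: norm_mult norm_power intro!: mult_left_le power_le_one)
        moreover have "(LBINT t:{0<..<1}. norm (G t * of_real t ^ n)) \<ge> 0"
          by (auto simp: set_lebesgue_integral_def intro!: integral_nonneg_AE)
        ultimately show ?thesis by (simp add: abs_mult mult_left_mono)
      qed
      have "summable (\<lambda>n. norm (pochhammer \<sigma> n / fact n * u ^ n) * (LBINT t:{0<..<1}. norm (G t)))"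
        by (intro summable_mult2 binomial_series_pochhammer u)
      thus "summable (\<lambda>n. LBINT t:{0<..<1}. norm (?f n t))"
        by (rule summable_comparison_test'[where N = 0]) (rule le)
    qed
    moreover have "(LBINT t:{0<..<1}. ?f n t) = pochhammer \<sigma> n / fact n * (LBINT t:{0<..<1}. G t * of_real t ^ n) * u ^ n" for n
      by (subst set_integral_mult_right) simp
    ultimately show ?case by (simp add: mult_ac)
  qed
qed

section \<open>Analytic continuation and Pfaff's transformation\<close>

text \<open>Only the expansion at 0 is prescribed, so that continuations can be built and checked by
  formal power series; agreement on the whole unit disc follows from holomorphy there.\<close>

definition hyp_continuation :: "complex \<Rightarrow> complex \<Rightarrow> complex \<Rightarrow> (complex \<Rightarrow> complex) \<Rightarrow> bool" where
  "hyp_continuation a b c f \<longleftrightarrow>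
     f holomorphic_on cut_plane \<and> f has_fps_expansion fps_hypergeo [a, b] [c] 1"

text \<open>By the identity theorem on the connected cut plane all continuations take the same value
  at z, so any one of them evaluates the definite description.\<close>

lemma hyp2F1_eqI:
  assumes f: "hyp_continuation a b c f" and z: "z \<in> cut_plane"
  shows "hyp2F1 a b c z = f z"
proof -
  have hol: "f holomorphic_on cut_plane" and exp: "f has_fps_expansion fps_hypergeo [a, b] [c] 1"
    using f by (auto simp: hyp_continuation_def)
  have ball: "f u = eval_fps (fps_hypergeo [a, b] [c] 1) u" if "u \<in> ball 0 1" for u
    using has_fps_expansion_imp_eval_fps_eq[OF exp, of u 1] that
      holomorphic_on_subset[OF hol unit_ball_subset_cut_plane] by simp
  show ?thesis unfolding hyp2F1_def cut_plane_def[symmetric]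
  proof (rule the_equality)
    show "\<exists>g. g holomorphic_on cut_plane \<and> (\<forall>u\<in>ball 0 1. g u = eval_fps (fps_hypergeo [a, b] [c] 1) u) \<and> g z = f z"
      using hol ball by blast
  next
    fix w assume "\<exists>g. g holomorphic_on cut_plane \<and>
        (\<forall>u\<in>ball 0 1. g u = eval_fps (fps_hypergeo [a, b] [c] 1) u) \<and> g z = w"
    then obtain g where g: "g holomorphic_on cut_plane"
      "\<And>u. u \<in> ball 0 1 \<Longrightarrow> g u = eval_fps (fps_hypergeo [a, b] [c] 1) u" "g z = w" by blast
    have "g z = f z"
      using g ball by (intro analytic_continuation_open[OF _ open_cut_plane _ connected_cut_plane
            unit_ball_subset_cut_plane g(1) hol _ z]) auto
    thus "w = f z" using g by simp
  qed
qed

section \<open>Existence of the continuation\<close>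

text \<open>Euler's integral. The n-th moment of its Beta weight is \<open>Beta b (c - b)\<close>
  times the quotient of the Pochhammer symbols of b and c, which completes the binomial coefficients
  of the kernel to hypergeometric ones.\<close>

lemma hyp_continuation_Euler:
  assumes b: "0 < Re b" and cb: "Re b < Re c"
  shows "\<exists>f. hyp_continuation a b c f"
proof -
  define G where "G = (\<lambda>t. of_real t powr (b - 1) * of_real (1 - t) powr (c - b - 1) :: complex)"
  have cb': "0 < Re (c - b)" using cb by simp
  have G: "set_integrable lborel {0<..<1} G"
    unfolding G_def by (rule set_integrable_Beta_complex[OF b cb'])
  have nn: "b \<notin> \<int>\<^sub>\<le>\<^sub>0" "c \<notin> \<int>\<^sub>\<le>\<^sub>0" "c - b \<notin> \<int>\<^sub>\<le>\<^sub>0" using b cb by (auto intro!: Re_pos_not_nonpos_Int)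
  have mom: "(LBINT t:{0<..<1}. G t * of_real t ^ n) = Beta b (c - b) * (pochhammer b n / pochhammer c n)" for n
  proof -
    have "(LBINT t:{0<..<1}. G t * of_real t ^ n) =
       (LBINT t:{0<..<1}. of_real t powr (b + of_nat n - 1) * of_real (1 - t) powr (c - b - 1))"
      by (intro set_lebesgue_integral_cong)
         (auto simp: G_def diff_add_eq[symmetric] powr_add powr_nat')
    also have "\<dots> = Beta (b + of_nat n) (c - b)"
      using b cb' by (intro Beta_integral_complex) auto
    also have "\<dots> = Beta b (c - b) * (pochhammer b n / pochhammer c n)"
      using nn by (subst Beta_add_of_nat_left) auto
    finally show ?thesis .
  qed
  have B: "Beta b (c - b) \<noteq> 0" using nn by (auto simp: Beta_def Gamma_eq_zero_iff)
  let ?f = "\<lambda>u. inverse (Beta b (c - b)) * (LBINT t:{0<..<1}. G t * (1 - u * of_real t) powr (- a))"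
  have "?f has_fps_expansion fps_const (inverse (Beta b (c - b))) *
      Abs_fps (\<lambda>n. pochhammer a n / fact n * (LBINT t:{0<..<1}. G t * of_real t ^ n))"
    by (intro has_fps_expansion_cmult_left kernel_transform_expansion G)
  also have "fps_const (inverse (Beta b (c - b))) *
      Abs_fps (\<lambda>n. pochhammer a n / fact n * (LBINT t:{0<..<1}. G t * of_real t ^ n)) = fps_hypergeo [a, b] [c] 1"
    using B by (intro fps_ext) (simp add: mom mult_ac)
  finally have "hyp_continuation a b c ?f"
    using kernel_transform_holomorphic[OF G] by (auto simp: hyp_continuation_def intro!: holomorphic_intros)
  thus ?thesis by blast
qed

text \<open>The operator z d/dz multiplies the n-th coefficient by n. The whole expression
  multiplies it by \<open>(c + n) / c\<close>, the ratio of the coefficients for c and for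
  \<open>c + 1\<close>.\<close>

lemma hyp_continuation_lower_c:
  assumes "hyp_continuation a b (c + 1) f" "c \<notin> \<int>\<^sub>\<le>\<^sub>0"
  shows "hyp_continuation a b c (\<lambda>z. f z + z / c * deriv f z)"
proof -
  have hol: "f holomorphic_on cut_plane" and exp: "f has_fps_expansion fps_hypergeo [a, b] [c + 1] 1"
    using assms by (auto simp: hyp_continuation_def)
  have c: "c \<noteq> 0" using assms(2) by auto
  have "(\<lambda>z. f z + inverse c * (z * deriv f z)) has_fps_expansion
      fps_hypergeo [a, b] [c + 1] 1 + fps_const (inverse c) * (fps_X * fps_deriv (fps_hypergeo [a, b] [c + 1] 1))"
    by (intro fps_expansion_intros exp)
  also have "fps_hypergeo [a, b] [c + 1] 1 + fps_const (inverse c) * (fps_X * fps_deriv (fps_hypergeo [a, b] [c + 1] 1))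
     = fps_hypergeo [a, b] [c] 1" (is "?L = _")
  proof (rule fps_ext)
    fix n
    have cn: "c + of_nat n \<noteq> 0" using not_nonpos_Int_add_of_nat[OF assms(2), of n] by auto
    have p: "pochhammer (c + 1) n = (c + of_nat n) * pochhammer c n / c"
      using c pochhammer_plus1[of c n] by (auto simp: eq_divide_eq mult.commute)
    have "fps_nth ?L n = hyp_coeff a b (c + 1) n * (1 + of_nat n / c)"
      by (cases n) (simp_all add: fps_nth_hypergeo_2_1 del: fps_hypergeo_nth add: field_simps)
    also have "1 + of_nat n / c = (c + of_nat n) / c" using c by (simp add: field_simps)
    also have "hyp_coeff a b (c + 1) n * ((c + of_nat n) / c) = hyp_coeff a b c n"
      using c cn by (simp add: hyp_coeff_def p)
    finally show "fps_nth ?L n = fps_nth (fps_hypergeo [a, b] [c] 1) n"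
      unfolding fps_nth_hypergeo_2_1 .
  qed
  finally have "(\<lambda>z. f z + z / c * deriv f z) has_fps_expansion fps_hypergeo [a, b] [c] 1"
    by (simp add: divide_inverse mult_ac)
  thus ?thesis using hol c unfolding hyp_continuation_def
    by (auto intro!: holomorphic_intros open_cut_plane)
qed

text \<open>With \<open>d = c - b - 1\<close>, comparing coefficients at \<open>Suc m\<close> and
  removing common factors leaves the polynomial identity
  \<open>(Suc m + d) * (b + 1 + m) - (c + m) * Suc m = d * b\<close>.\<close>

lemma hyp_continuation_lower_b:
  assumes "hyp_continuation a (b + 1) c f" and c: "c \<notin> \<int>\<^sub>\<le>\<^sub>0" and cb: "c - b - 1 \<noteq> 0"
  shows "hyp_continuation a b c (\<lambda>z. (z * (1 - z) * deriv f z + (c - b - 1 - a * z) * f z) / (c - b - 1))"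
proof -
  have hol: "f holomorphic_on cut_plane" and exp: "f has_fps_expansion fps_hypergeo [a, b + 1] [c] 1"
    using assms by (auto simp: hyp_continuation_def)
  define d where "d = c - b - 1"
  define H where "H = fps_hypergeo [a, b + 1] [c] 1"
  let ?H = "fps_X * (fps_deriv H - fps_X * fps_deriv H) + fps_const d * H - fps_const a * (fps_X * H)"
  have "(\<lambda>z. inverse d * (z * (deriv f z - z * deriv f z) + d * f z - a * (z * f z))) has_fps_expansion fps_const (inverse d) * ?H"
    using exp unfolding H_def by (intro fps_expansion_intros)
  also have "fps_const (inverse d) * ?H = fps_hypergeo [a, b] [c] 1"
  proof (rule fps_ext)
    fix n
    show "fps_nth (fps_const (inverse d) * ?H) n = fps_nth (fps_hypergeo [a, b] [c] 1) n"
    proof (cases n)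
      case (Suc m)
      have cm: "c + of_nat m \<noteq> 0" using not_nonpos_Int_add_of_nat[OF c, of m] by auto
      define T where "T = hyp_coeff a (b + 1) c m"
      define k where "k = (c + of_nat m) * of_nat (Suc m)"
      have k: "k \<noteq> 0" using cm by (auto simp: k_def simp del: of_nat_Suc)
      have 1: "hyp_coeff a (b + 1) c n = T * ((a + of_nat m) * (b + 1 + of_nat m) / k)"
        by (simp add: Suc T_def k_def hyp_coeff_def pochhammer_Suc mult_ac del: of_nat_Suc)
      have 2: "hyp_coeff a b c n = T * ((a + of_nat m) * b / k)"
        by (simp add: Suc T_def k_def hyp_coeff_def pochhammer_Suc[of a] pochhammer_Suc[of c] pochhammer_rec[of b]
            mult_ac del: of_nat_Suc)
      have "fps_nth ?H n = (of_nat (Suc m) + d) * hyp_coeff a (b + 1) c n - (of_nat m + a) * T"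
        unfolding H_def T_def
        by (cases m) (simp_all add: Suc fps_nth_hypergeo_2_1 algebra_simps del: fps_hypergeo_nth)
      also have "\<dots> = T * (a + of_nat m) * (((of_nat (Suc m) + d) * (b + 1 + of_nat m) - k) / k)"
        unfolding 1 using k by (simp add: field_simps)
      also have "(of_nat (Suc m) + d) * (b + 1 + of_nat m) - k = d * b"
        by (simp add: d_def k_def algebra_simps)
      also have "T * (a + of_nat m) * (d * b / k) = d * hyp_coeff a b c n" unfolding 2 by simp
      finally show ?thesis using cb by (simp add: fps_nth_hypergeo_2_1 d_def del: fps_hypergeo_nth)
    qed (use cb in \<open>simp add: H_def d_def\<close>)
  qed
  also have "(\<lambda>z. inverse d * (z * (deriv f z - z * deriv f z) + d * f z - a * (z * f z))) =
     (\<lambda>z. (z * (1 - z) * deriv f z + (c - b - 1 - a * z) * f z) / (c - b - 1))"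
    by (auto simp: d_def divide_inverse algebra_simps)
  finally show ?thesis using hol cb unfolding hyp_continuation_def
    by (auto intro!: holomorphic_intros open_cut_plane)
qed

text \<open>The shifts N and M bring b and c into the range of Euler's integral. Then b is lowered
  back first, while \<open>Re (c + M)\<close> exceeds \<open>Re (b + N)\<close> and so keeps the
  divisor \<open>c - b - 1\<close> of each step nonzero; c is lowered afterwards.\<close>

lemma hyp_continuation_exists:
  assumes c: "c \<notin> \<int>\<^sub>\<le>\<^sub>0"
  shows "\<exists>f. hyp_continuation a b c f"
proof -
  define N where "N = nat \<lceil>1 - Re b\<rceil>"
  have N: "Re (b + of_nat N) > 0" by (simp add: N_def) linarith
  define M where "M = nat \<lceil>1 + Re b + real N - Re c\<rceil>"
  have M: "Re (b + of_nat N) < Re (c + of_nat M)" by (simp add: M_def) linarith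
  have cM: "c + of_nat k \<notin> \<int>\<^sub>\<le>\<^sub>0" for k using not_nonpos_Int_add_of_nat[OF c] .
  have "\<exists>f. hyp_continuation a (b + of_nat (N - k)) (c + of_nat M) f" if "k \<le> N" for k
    using that
  proof (induction k)
    case 0
    show ?case using hyp_continuation_Euler[OF N M] by simp
  next
    case (Suc k)
    have e: "b + of_nat (N - k) = b + of_nat (N - Suc k) + 1"
      using Suc.prems by (subst Suc_diff_Suc[symmetric]) (auto simp: add_ac)
    obtain f where f: "hyp_continuation a (b + of_nat (N - Suc k) + 1) (c + of_nat M) f"
      using Suc.IH Suc.prems unfolding e by auto
    have "real (N - Suc k) + 1 \<le> real N" using Suc.prems by linarith
    hence "Re (c + of_nat M - (b + of_nat (N - Suc k)) - 1) > 0" using M by simp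
    hence "c + of_nat M - (b + of_nat (N - Suc k)) - 1 \<noteq> 0" by force
    from hyp_continuation_lower_b[OF f cM this] show ?case by blast
  qed
  from this[of N] have 1: "\<exists>f. hyp_continuation a b (c + of_nat M) f" by simp
  have "\<exists>f. hyp_continuation a b (c + of_nat (M - k)) f" if "k \<le> M" for k
    using that
  proof (induction k)
    case 0
    show ?case using 1 by simp
  next
    case (Suc k)
    have e: "c + of_nat (M - k) = c + of_nat (M - Suc k) + 1"
      using Suc.prems by (subst Suc_diff_Suc[symmetric]) (auto simp: add_ac)
    obtain f where f: "hyp_continuation a b (c + of_nat (M - Suc k) + 1) f"
      using Suc.IH Suc.prems unfolding e by auto
    from hyp_continuation_lower_c[OF f cM] show ?case by blast
  qed
  from this[of M] show ?thesis by simp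
qed

lemma hyp_continuation_hyp2F1:
  assumes "c \<notin> \<int>\<^sub>\<le>\<^sub>0"
  shows "hyp_continuation a b c (hyp2F1 a b c)"
proof -
  obtain f where f: "hyp_continuation a b c f" using hyp_continuation_exists[OF assms] by blast
  have eq: "hyp2F1 a b c z = f z" if "z \<in> cut_plane" for z using hyp2F1_eqI[OF f that] .
  have ev: "eventually (\<lambda>z. f z = hyp2F1 a b c z) (nhds 0)"
    using eventually_nhds_in_open[OF open_cut_plane zero_in_cut_plane] by eventually_elim (simp add: eq)
  show ?thesis using f has_fps_expansion_cong[OF ev refl] holomorphic_cong[OF refl eq]
    by (auto simp: hyp_continuation_def)
qed

lemma hyp2F1_eq_series:
  assumes "c \<notin> \<int>\<^sub>\<le>\<^sub>0" "norm z < 1"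
  shows "hyp2F1 a b c z = eval_fps (fps_hypergeo [a, b] [c] 1) z"
  using has_fps_expansion_imp_eval_fps_eq[of "hyp2F1 a b c" _ z 1] hyp_continuation_hyp2F1[OF assms(1), of a b] assms(2)
    holomorphic_on_subset[OF _ unit_ball_subset_cut_plane] by (auto simp: hyp_continuation_def)

lemma hyp2F1_commute: "hyp2F1 a b c = hyp2F1 b a c"
proof -
  have "fps_hypergeo [a, b] [c] 1 = fps_hypergeo [b, a] [c] 1"
    by (intro fps_ext) simp
  thus ?thesis unfolding hyp2F1_def by simp
qed

section \<open>Pfaff's transformation by comparison of coefficients\<close>

definition neg_binomial_fps :: "complex \<Rightarrow> complex fps" where
  "neg_binomial_fps s = Abs_fps (\<lambda>n. pochhammer s n / fact n)"

lemma has_fps_expansion_neg_binomial: "(\<lambda>z. (1 - z) powr (- s)) has_fps_expansion neg_binomial_fps s"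
proof (rule has_fps_expansionI)
  have "eventually (\<lambda>u. u \<in> ball (0::complex) 1) (nhds 0)"
    by (intro eventually_nhds_in_open) auto
  thus "eventually (\<lambda>u. (\<lambda>n. fps_nth (neg_binomial_fps s) n * u ^ n) sums ((1 - u) powr (- s))) (nhds 0)"
    by eventually_elim (use binomial_series_pochhammer(1) in \<open>auto simp: neg_binomial_fps_def\<close>)
qed

text \<open>A Vandermonde convolution, obtained from the exponent law of \<open>powr\<close> and the
  uniqueness of expansions.\<close>

lemma neg_binomial_fps_add: "neg_binomial_fps s * neg_binomial_fps t = neg_binomial_fps (s + t)"
proof -
  have "(\<lambda>z. (1 - z) powr (- s) * (1 - z) powr (- t)) has_fps_expansion neg_binomial_fps s * neg_binomial_fps t"
    by (intro has_fps_expansion_mult has_fps_expansion_neg_binomial)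
  moreover have "(\<lambda>z. (1 - z) powr (- (s + t))) has_fps_expansion neg_binomial_fps (s + t)"
    by (rule has_fps_expansion_neg_binomial)
  moreover have "(\<lambda>z. (1 - z) powr (- s) * (1 - z) powr (- t)) = (\<lambda>z::complex. (1 - z) powr (- (s + t)))"
    by (auto simp: powr_add[symmetric])
  ultimately show ?thesis using fps_expansion_unique_complex by metis
qed

lemma neg_binomial_fps_mult_power:
  "neg_binomial_fps s * neg_binomial_fps 1 ^ i = neg_binomial_fps (s + of_nat i)"
proof (induction i)
  case (Suc i)
  have "neg_binomial_fps s * neg_binomial_fps 1 ^ Suc i = (neg_binomial_fps s * neg_binomial_fps 1 ^ i) * neg_binomial_fps 1"
    by (simp add: mult_ac)
  thus ?case unfolding Suc neg_binomial_fps_add by (simp add: add_ac)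
qed simp

text \<open>As V has no constant term, \<open>V ^ i\<close> does not reach the coefficient
  \<open>N - j\<close> once i exceeds \<open>N - j\<close>. All inner sums may therefore run up to
  the common bound N, and P can be moved inside.\<close>

lemma fps_mult_compose_nth:
  fixes P H V :: "'a::comm_ring_1 fps"
  assumes V: "fps_nth V 0 = 0"
  shows "fps_nth (P * (H oo V)) N = (\<Sum>i\<le>N. fps_nth H i * fps_nth (P * V ^ i) N)"
proof -
  have "fps_nth (P * (H oo V)) N = fps_nth (P * (\<Sum>i\<le>N. fps_const (fps_nth H i) * V ^ i)) N"
    unfolding fps_mult_nth
  proof (intro sum.cong refl arg_cong2[of _ _ _ _ "(*)"])
    fix j assume "j \<in> {0..N}"
    have "fps_nth (\<Sum>i\<le>N. fps_const (fps_nth H i) * V ^ i) (N - j) = (\<Sum>i\<le>N. fps_nth H i * fps_nth (V ^ i) (N - j))"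
      by (simp add: fps_sum_nth)
    also have "\<dots> = (\<Sum>i=0..N-j. fps_nth H i * fps_nth (V ^ i) (N - j))"
      using startsby_zero_power_prefix[OF V] by (intro sum.mono_neutral_right) auto
    finally show "fps_nth (H oo V) (N - j) = fps_nth (\<Sum>i\<le>N. fps_const (fps_nth H i) * V ^ i) (N - j)"
      by (simp add: fps_compose_nth)
  qed
  also have "P * (\<Sum>i\<le>N. fps_const (fps_nth H i) * V ^ i) = (\<Sum>i\<le>N. fps_const (fps_nth H i) * (P * V ^ i))"
    by (simp add: sum_distrib_left mult_ac)
  finally show ?thesis by (simp add: fps_sum_nth)
qed

text \<open>Here \<open>(-1) ^ i / fact (N - i)\<close> equals
  \<open>pochhammer (- N) i / fact N\<close>, and the two Pochhammer symbols in p join to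
  \<open>pochhammer p N\<close>. What remains is a terminating series at 1, summed by the
  Chu-Vandermonde identity.\<close>

lemma Pfaff_coefficients:
  assumes r: "r \<notin> \<int>\<^sub>\<le>\<^sub>0"
  shows "(\<Sum>i\<le>N. hyp_coeff p q r i * ((-1) ^ i * (pochhammer (p + of_nat i) (N - i) / fact (N - i)))) =
           hyp_coeff p (r - q) r N"
proof -
  have "(\<Sum>i\<le>N. hyp_coeff p q r i * ((-1) ^ i * (pochhammer (p + of_nat i) (N - i) / fact (N - i)))) =
     (\<Sum>i\<in>{0..N}. pochhammer p N / fact N *
        (pochhammer q i * pochhammer (- of_nat N) i / (of_nat (fact i) * pochhammer r i)))"
  proof (intro sum.cong)
    fix i assume i: "i \<in> {0..N}"
    have 1: "pochhammer p i * pochhammer (p + of_nat i) (N - i) = pochhammer p N"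
      using i by (subst pochhammer_product[of i N p]) auto
    have "(of_nat (N choose i) :: complex) = (-1) ^ i * pochhammer (- of_nat N) i / fact i"
      unfolding binomial_gbinomial gbinomial_pochhammer ..
    moreover have "(of_nat (N choose i) :: complex) = fact N / (fact i * fact (N - i))"
      using i by (intro binomial_fact) auto
    ultimately have "(-1) ^ i * pochhammer (- of_nat N) i / fact i = (fact N / (fact i * fact (N - i)) :: complex)"
      by simp
    hence 2: "pochhammer (- of_nat N) i = (-1) ^ i * (fact N / fact (N - i) :: complex)"
      by (cases "even i") (simp_all add: field_simps, metis minus_minus)
    have "hyp_coeff p q r i * ((-1) ^ i * (pochhammer (p + of_nat i) (N - i) / fact (N - i))) =
       (pochhammer p i * pochhammer (p + of_nat i) (N - i)) * (pochhammer q i * (-1) ^ i / (pochhammer r i * fact i * fact (N - i)))"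
      by (simp add: hyp_coeff_def)
    also have "\<dots> = pochhammer p N / fact N *
        (pochhammer q i * pochhammer (- of_nat N) i / (of_nat (fact i) * pochhammer r i))"
      unfolding 1 2 by (simp add: field_simps)
    finally show "hyp_coeff p q r i * ((-1) ^ i * (pochhammer (p + of_nat i) (N - i) / fact (N - i))) = \<dots>" .
  qed auto
  also have "\<dots> = pochhammer p N / fact N * (pochhammer (r - q) N / pochhammer r N)"
    unfolding sum_distrib_left[symmetric] using r
    by (subst Vandermonde_pochhammer) auto
  finally show ?thesis by (simp add: hyp_coeff_def mult_ac)
qed

lemma cut_plane_Pfaff:
  assumes "z \<in> cut_plane"
  shows "z / (z - 1) \<in> cut_plane"
proof -
  have z: "1 - z \<notin> \<real>\<^sub>\<le>\<^sub>0" "z \<noteq> 1" using assms by (auto simp: cut_plane_iff)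
  have "1 - z / (z - 1) = inverse (1 - z)" using z by (simp add: field_simps)
  thus ?thesis using z nonpos_Reals_inverse_iff[of "1 - z"] unfolding cut_plane_iff by simp
qed

text \<open>The right-hand side is holomorphic because \<open>z / (z - 1)\<close> maps the cut plane
  into itself, so it is enough to compare expansions at 0. The inner map expands as -X/(1 - X); its
  i-th power times the prefactor is again a negative binomial series, shifted by i.\<close>

theorem Pfaff_transformation:
  assumes r: "r \<notin> \<int>\<^sub>\<le>\<^sub>0" and z: "z \<in> cut_plane"
  shows "hyp2F1 p (r - q) r z = (1 - z) powr (- p) * hyp2F1 p q r (z / (z - 1))"
proof (rule hyp2F1_eqI[OF _ z])
  let ?f = "\<lambda>z. (1 - z) powr (- p) * hyp2F1 p q r (z / (z - 1))"
  have hol: "hyp2F1 p q r holomorphic_on cut_plane" and exp: "hyp2F1 p q r has_fps_expansion fps_hypergeo [p, q] [r] 1"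
    using hyp_continuation_hyp2F1[OF r] by (auto simp: hyp_continuation_def)
  have "(\<lambda>z. z / (z - 1)) holomorphic_on cut_plane"
    by (intro holomorphic_intros) (auto simp: cut_plane_iff)
  from holomorphic_on_compose_gen[OF this hol] have "(\<lambda>z. hyp2F1 p q r (z / (z - 1))) holomorphic_on cut_plane"
    using cut_plane_Pfaff by (auto simp: o_def)
  hence holf: "?f holomorphic_on cut_plane"
    by (intro holomorphic_intros) (auto simp: cut_plane_iff)
  let ?V = "- (fps_X * neg_binomial_fps 1)"
  have "(\<lambda>z::complex. - (z * (1 - z) powr (- 1))) has_fps_expansion ?V"
    by (intro fps_expansion_intros has_fps_expansion_neg_binomial)
  also have "?this \<longleftrightarrow> (\<lambda>z::complex. z / (z - 1)) has_fps_expansion ?V"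
  proof (rule has_fps_expansion_cong[OF _ refl])
    show "eventually (\<lambda>z::complex. - (z * (1 - z) powr (- 1)) = z / (z - 1)) (nhds 0)"
      using eventually_nhds_in_open[OF open_cut_plane zero_in_cut_plane]
      by eventually_elim (auto simp: powr_minus divide_inverse[symmetric] minus_divide_right)
  qed
  finally have V: "(\<lambda>z::complex. z / (z - 1)) has_fps_expansion ?V" .
  have "?f has_fps_expansion neg_binomial_fps p * (fps_hypergeo [p, q] [r] 1 oo ?V)"
    using has_fps_expansion_compose[OF exp V] by (intro has_fps_expansion_mult has_fps_expansion_neg_binomial) (auto simp: o_def)
  also have "neg_binomial_fps p * (fps_hypergeo [p, q] [r] 1 oo ?V) = fps_hypergeo [p, r - q] [r] 1"
  proof (rule fps_ext)
    fix N
    have "fps_nth (neg_binomial_fps p * ?V ^ i) N = (-1) ^ i * (pochhammer (p + of_nat i) (N - i) / fact (N - i))"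
      if "i \<le> N" for i
    proof -
      have "neg_binomial_fps p * ?V ^ i = fps_const ((-1) ^ i) * (fps_X ^ i * (neg_binomial_fps p * neg_binomial_fps 1 ^ i))"
        by (subst power_minus) (simp add: power_mult_distrib mult_ac fps_const_power[symmetric] fps_const_neg[symmetric])
      thus ?thesis using that
        unfolding neg_binomial_fps_mult_power by (simp add: fps_X_power_mult_nth neg_binomial_fps_def)
    qed
    hence "fps_nth (neg_binomial_fps p * (fps_hypergeo [p, q] [r] 1 oo ?V)) N =
      (\<Sum>i\<le>N. hyp_coeff p q r i * ((-1) ^ i * (pochhammer (p + of_nat i) (N - i) / fact (N - i))))"
      by (subst fps_mult_compose_nth) (auto simp: fps_nth_hypergeo_2_1 simp del: fps_hypergeo_nth)
    thus "fps_nth (neg_binomial_fps p * (fps_hypergeo [p, q] [r] 1 oo ?V)) N = fps_nth (fps_hypergeo [p, r - q] [r] 1) N"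
      unfolding fps_nth_hypergeo_2_1 Pfaff_coefficients[OF r] .
  qed
  finally show "hyp_continuation p (r - q) r ?f"
    using holf by (simp add: hyp_continuation_def)
qed

section \<open>The fractional integrals\<close>

lemma set_integral_reflect_unit:
  fixes f :: "real \<Rightarrow> complex"
  shows "set_integrable lborel {0<..<1} (\<lambda>t. f (1 - t)) \<longleftrightarrow> set_integrable lborel {0<..<1} f"
    and "(LBINT t:{0<..<1}. f (1 - t)) = (LBINT t:{0<..<1}. f t)"
proof -
  have ind: "indicat_real {0<..<1} (1 - t) = indicat_real {0<..<1} t" for t :: real
    by (auto simp: indicator_def)
  show "set_integrable lborel {0<..<1} (\<lambda>t. f (1 - t)) \<longleftrightarrow> set_integrable lborel {0<..<1} f"
    using lborel_integrable_real_affine_iff[of "-1" "\<lambda>t. indicat_real {0<..<1} t *\<^sub>R f t" 1]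
    by (simp add: set_integrable_def ind)
  show "(LBINT t:{0<..<1}. f (1 - t)) = (LBINT t:{0<..<1}. f t)"
    using lborel_integral_real_affine[of "-1" "\<lambda>t. indicat_real {0<..<1} t *\<^sub>R f t" 1]
    by (simp add: set_lebesgue_integral_def ind)
qed

lemma cut_plane_fps_expansion_unique:
  assumes "f holomorphic_on cut_plane" "g holomorphic_on cut_plane"
    and "f has_fps_expansion F" "g has_fps_expansion F" and z: "z \<in> cut_plane"
  shows "f z = g z"
proof (rule analytic_continuation_open[OF _ open_cut_plane _ connected_cut_plane
            unit_ball_subset_cut_plane assms(1,2) _ z])
  fix w :: complex assume w: "w \<in> ball 0 1"
  have "eval_fps F w = f w" "eval_fps F w = g w"
    using w assms holomorphic_on_subset[OF _ unit_ball_subset_cut_plane]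
    by (intro has_fps_expansion_imp_eval_fps_eq[of _ _ _ 1]; simp)+
  thus "f w = g w" by simp
qed auto

lemma one_minus_mult_pos:
  fixes z s :: real
  assumes "z < 1" "0 < s" "s < 1"
  shows "1 - z * s > 0"
proof (cases "z \<le> 0")
  case True
  hence "z * s \<le> 0" using assms by (simp add: mult_nonpos_nonneg)
  thus ?thesis by simp
next
  case False
  hence "z * s < 1 * 1" using assms by (intro mult_strict_mono) auto
  thus ?thesis by simp
qed

lemma powr_mult_pos:
  "0 < x \<Longrightarrow> 0 < y \<Longrightarrow> (of_real (x * y) :: complex) powr s = of_real x powr s * of_real y powr s"
  by (simp add: powr_times_real)

section \<open>The common integral over (0,1)\<close>

text \<open>After reflection, multiplying by \<open>t ^ n\<close> only changes \<rho> into
  \<open>\<rho> + n\<close> in \<open>hypergeo_moment\<close>. With the exponent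
  \<open>C + \<rho> - A\<close> the binomial coefficients of the kernel cancel one of the resulting
  Pochhammer symbols, and a constant times a single hypergeometric series is left.\<close>

lemma hypergeo_weighted_kernel_transform:
  assumes C: "0 < Re C" and \<rho>: "0 < Re \<rho>" and \<delta>: "0 < Re (C + \<rho> - A - B)"
    and r: "C + \<rho> - B \<notin> \<int>\<^sub>\<le>\<^sub>0" and u: "u \<in> cut_plane"
  defines "G \<equiv> (\<lambda>t. of_real (1 - t) powr (C - 1) * of_real t powr (\<rho> - 1) * hyp2F1 A B C (of_real (1 - t)))"
  shows "set_integrable lborel {0<..<1} G"
    and "(LBINT t:{0<..<1}. G t * (1 - u * of_real t) powr (- (C + \<rho> - A))) =
           Gamma C * Gamma \<rho> * Gamma (C + \<rho> - A - B) * rGamma (C + \<rho> - A) * rGamma (C + \<rho> - B) *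
           hyp2F1 \<rho> (C + \<rho> - A - B) (C + \<rho> - B) u"
proof -
  define \<sigma> where "\<sigma> = C + \<rho> - A"
  define d where "d = C + \<rho> - A - B"
  define q where "q = C + \<rho> - B"
  define K where "K = Gamma C * Gamma \<rho> * Gamma d * rGamma \<sigma> * rGamma q"
  have C': "C \<notin> \<int>\<^sub>\<le>\<^sub>0" and \<rho>': "\<rho> \<notin> \<int>\<^sub>\<le>\<^sub>0" and d': "d \<notin> \<int>\<^sub>\<le>\<^sub>0"
    using C \<rho> \<delta> by (auto intro!: Re_pos_not_nonpos_Int simp: d_def)
  have q': "q \<notin> \<int>\<^sub>\<le>\<^sub>0" using r by (simp add: q_def)
  define g where "g = (\<lambda>n t. of_real t powr (C - 1) * of_real (1 - t) powr (\<rho> + of_nat n - 1) *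
                    eval_fps (fps_hypergeo [A, B] [C] 1) (complex_of_real t))"
  have gG: "g n (1 - t) = G t * of_real t ^ n" if "t \<in> {0<..<1}" for n t
  proof -
    have "hyp2F1 A B C (of_real (1 - t)) = eval_fps (fps_hypergeo [A, B] [C] 1) (of_real (1 - t))"
      using that C' by (intro hyp2F1_eq_series) (auto simp del: of_real_diff)
    moreover have "of_real t powr (\<rho> + of_nat n - 1) = of_real t powr (\<rho> - 1) * (of_real t :: complex) ^ n"
      using that by (simp add: diff_add_eq[symmetric] powr_add powr_nat')
    ultimately show ?thesis by (simp add: g_def G_def)
  qed
  have \<rho>n: "0 < Re (\<rho> + of_nat n)" "0 < Re (C + (\<rho> + of_nat n) - A - B)" for n
    using \<rho> \<delta> by auto
  have gi: "set_integrable lborel {0<..<1} (g n)" for n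
    unfolding g_def by (rule hypergeo_moment(1)[OF C \<rho>n])
  have "set_integrable lborel {0<..<1} (\<lambda>t. g 0 (1 - t))"
    using gi[of 0] set_integral_reflect_unit(1) by blast
  thus Gi: "set_integrable lborel {0<..<1} G"
    using set_integrable_cong[of lborel lborel "{0<..<1}" "{0<..<1}" "\<lambda>t. g 0 (1 - t)" G] gG[of _ 0] by simp
  have mom: "pochhammer \<sigma> n / fact n * (LBINT t:{0<..<1}. G t * of_real t ^ n) = K * hyp_coeff \<rho> d q n" for n
  proof -
    have "(LBINT t:{0<..<1}. G t * of_real t ^ n) = (LBINT t:{0<..<1}. g n (1 - t))"
      using gG by (intro set_lebesgue_integral_cong) auto
    also have "\<dots> = (LBINT t:{0<..<1}. g n t)" by (rule set_integral_reflect_unit)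
    also have "\<dots> = Gamma C * Gamma (\<rho> + of_nat n) * Gamma (C + (\<rho> + of_nat n) - A - B) *
        rGamma (C + (\<rho> + of_nat n) - A) * rGamma (C + (\<rho> + of_nat n) - B)"
      unfolding g_def by (rule hypergeo_moment(2)[OF C \<rho>n])
    also have "C + (\<rho> + of_nat n) - A - B = d + of_nat n" by (simp add: d_def)
    also have "C + (\<rho> + of_nat n) - A = \<sigma> + of_nat n" by (simp add: \<sigma>_def)
    also have "C + (\<rho> + of_nat n) - B = q + of_nat n" by (simp add: q_def)
    finally have "pochhammer \<sigma> n / fact n * (LBINT t:{0<..<1}. G t * of_real t ^ n) =
       Gamma C * Gamma \<rho> * Gamma d * (pochhammer \<sigma> n * rGamma (\<sigma> + of_nat n)) * rGamma q * hyp_coeff \<rho> d q n"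
      unfolding Gamma_add_of_nat[OF \<rho>'] Gamma_add_of_nat[OF d'] rGamma_add_of_nat[OF q']
      by (simp add: hyp_coeff_def mult_ac)
    \<comment> \<open>The cancellation uses \<open>rGamma\<close>, so it is valid at nonpositive
      integers \<sigma> too, where both sides vanish.\<close>
    thus ?thesis unfolding pochhammer_rGamma[of \<sigma> n, symmetric] K_def .
  qed
  have "(\<lambda>u. LBINT t:{0<..<1}. G t * (1 - u * of_real t) powr (- \<sigma>)) has_fps_expansion
      Abs_fps (\<lambda>n. pochhammer \<sigma> n / fact n * (LBINT t:{0<..<1}. G t * of_real t ^ n))"
    by (rule kernel_transform_expansion[OF Gi])
  also have "Abs_fps (\<lambda>n. pochhammer \<sigma> n / fact n * (LBINT t:{0<..<1}. G t * of_real t ^ n)) =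
      fps_const K * fps_hypergeo [\<rho>, d] [q] 1"
    unfolding mom by (intro fps_ext) (simp add: hyp_coeff_def)
  finally have 1: "(\<lambda>u. LBINT t:{0<..<1}. G t * (1 - u * of_real t) powr (- \<sigma>)) has_fps_expansion
      fps_const K * fps_hypergeo [\<rho>, d] [q] 1" .
  have "hyp_continuation \<rho> d q (hyp2F1 \<rho> d q)" by (rule hyp_continuation_hyp2F1[OF q'])
  hence 2: "(\<lambda>u. K * hyp2F1 \<rho> d q u) has_fps_expansion fps_const K * fps_hypergeo [\<rho>, d] [q] 1"
    and 3: "(\<lambda>u. K * hyp2F1 \<rho> d q u) holomorphic_on cut_plane"
    by (auto simp: hyp_continuation_def intro!: has_fps_expansion_cmult_left holomorphic_intros)
  have "(LBINT t:{0<..<1}. G t * (1 - u * of_real t) powr (- \<sigma>)) = K * hyp2F1 \<rho> d q u"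
    using cut_plane_fps_expansion_unique[OF kernel_transform_holomorphic[OF Gi] 3 1 2 u] .
  thus "(LBINT t:{0<..<1}. G t * (1 - u * of_real t) powr (- (C + \<rho> - A))) =
           Gamma C * Gamma \<rho> * Gamma (C + \<rho> - A - B) * rGamma (C + \<rho> - A) * rGamma (C + \<rho> - B) *
           hyp2F1 \<rho> (C + \<rho> - A - B) (C + \<rho> - B) u"
    unfolding K_def \<sigma>_def d_def q_def .
qed

theorem hypergeo_fractional_integral:
  assumes C: "0 < Re C" and \<rho>: "0 < Re \<rho>" and \<delta>: "0 < Re (C + \<rho> - A - B)"
    and r: "C + \<rho> - B \<notin> \<int>\<^sub>\<le>\<^sub>0" and z: "z < 1"
  defines "f \<equiv> (\<lambda>s. of_real s powr (C - 1) * of_real (1 - s) powr (\<rho> - 1) * hyp2F1 A B C (of_real s) *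
                    of_real (1 - z * s) powr (- (C + \<rho> - A)))"
  shows "set_integrable lborel {0<..<1} f"
    and "(LBINT s:{0<..<1}. f s) =
           Gamma C * Gamma \<rho> * Gamma (C + \<rho> - A - B) * rGamma (C + \<rho> - A) * rGamma (C + \<rho> - B) *
           of_real (1 - z) powr (A - C) * hyp2F1 \<rho> A (C + \<rho> - B) (of_real z)"
proof -
  define \<sigma> where "\<sigma> = C + \<rho> - A"
  define u where "u = z / (z - 1)"
  have u1: "1 - u = 1 / (1 - z)" using z by (simp add: u_def field_simps)
  hence "1 - u > 0" using z by simp
  hence u: "of_real u \<in> cut_plane" by (simp add: of_real_in_cut_plane_iff)
  define G where "G = (\<lambda>t. of_real (1 - t) powr (C - 1) * of_real t powr (\<rho> - 1) * hyp2F1 A B C (of_real (1 - t)))"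
  have f: "f (1 - t) = of_real (1 - z) powr (- \<sigma>) * (G t * (1 - of_real u * of_real t) powr (- \<sigma>))"
    if t: "t \<in> {0<..<1}" for t
  proof -
    \<comment> \<open>This factorisation determines u; both factors are positive, so the power
      splits without crossing a branch.\<close>
    have e: "1 - z * (1 - t) = (1 - z) * (1 - u * t)" using z by (simp add: u_def field_simps)
    have pos: "1 - u * t > 0" using t \<open>1 - u > 0\<close> by (intro one_minus_mult_pos) auto
    have "(of_real (1 - z * (1 - t)) :: complex) powr (- \<sigma>) = of_real (1 - z) powr (- \<sigma>) * of_real (1 - u * t) powr (- \<sigma>)"
      unfolding e using z pos by (intro powr_mult_pos) auto
    thus ?thesis unfolding f_def G_def \<sigma>_def[symmetric] by simp
  qed
  have tr: "set_integrable lborel {0<..<1} G"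
    "(LBINT t:{0<..<1}. G t * (1 - of_real u * of_real t) powr (- \<sigma>)) =
       Gamma C * Gamma \<rho> * Gamma (\<sigma> - B) * rGamma \<sigma> * rGamma (C + \<rho> - B) *
       hyp2F1 \<rho> (\<sigma> - B) (C + \<rho> - B) (of_real u)"
    using hypergeo_weighted_kernel_transform[OF C \<rho> \<delta> r u] unfolding G_def \<sigma>_def by auto
  have "set_integrable lborel {0<..<1} (\<lambda>t. of_real (1 - z) powr (- \<sigma>) * (G t * (1 - of_real u * of_real t) powr (- \<sigma>)))"
    by (intro set_integrable_mult_right set_integrable_kernel tr(1) u)
  hence "set_integrable lborel {0<..<1} (\<lambda>t. f (1 - t))"
    using set_integrable_cong[of lborel lborel "{0<..<1}" "{0<..<1}" "\<lambda>t. f (1 - t)", OF refl refl f] by simp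
  thus "set_integrable lborel {0<..<1} f" by (simp only: set_integral_reflect_unit)
  have zc: "of_real z \<in> cut_plane" using z by (simp add: of_real_in_cut_plane_iff)
  have uz: "of_real z / (of_real z - 1) = complex_of_real u" by (simp add: u_def)
  \<comment> \<open>Pfaff's transformation with \<open>q = \<sigma> - B\<close>: the complementary
    parameter \<open>r - q\<close> is then A, and the argument returns from u to z.\<close>
  have "hyp2F1 \<rho> (C + \<rho> - B - (\<sigma> - B)) (C + \<rho> - B) (of_real z) =
      (1 - of_real z) powr (- \<rho>) * hyp2F1 \<rho> (\<sigma> - B) (C + \<rho> - B) (of_real u)"
    using Pfaff_transformation[OF r zc, of \<rho> "\<sigma> - B"] unfolding uz .
  also have "C + \<rho> - B - (\<sigma> - B) = A" by (simp add: \<sigma>_def)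
  finally have "of_real (1 - z) powr \<rho> * hyp2F1 \<rho> A (C + \<rho> - B) (of_real z) =
      (of_real (1 - z) powr \<rho> * of_real (1 - z) powr (- \<rho>)) * hyp2F1 \<rho> (\<sigma> - B) (C + \<rho> - B) (of_real u)"
    by simp
  also have "of_real (1 - z) powr \<rho> * of_real (1 - z) powr (- \<rho>) = (1 :: complex)"
    using z by (simp flip: powr_add del: of_real_diff)
  finally have pf: "hyp2F1 \<rho> (\<sigma> - B) (C + \<rho> - B) (of_real u) =
      of_real (1 - z) powr \<rho> * hyp2F1 \<rho> A (C + \<rho> - B) (of_real z)" by simp
  have pw: "of_real (1 - z) powr (- \<sigma>) * of_real (1 - z) powr \<rho> = (of_real (1 - z) powr (A - C) :: complex)"
    by (subst powr_add[symmetric]) (simp add: \<sigma>_def)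
  have "(LBINT s:{0<..<1}. f s) = (LBINT t:{0<..<1}. f (1 - t))"
    by (rule set_integral_reflect_unit(2)[symmetric])
  also have "\<dots> = (LBINT t:{0<..<1}. of_real (1 - z) powr (- \<sigma>) * (G t * (1 - of_real u * of_real t) powr (- \<sigma>)))"
    using f by (intro set_lebesgue_integral_cong) auto
  also have "\<dots> = of_real (1 - z) powr (- \<sigma>) * (Gamma C * Gamma \<rho> * Gamma (\<sigma> - B) * rGamma \<sigma> * rGamma (C + \<rho> - B) *
           hyp2F1 \<rho> (\<sigma> - B) (C + \<rho> - B) (of_real u))"
    by (subst set_integral_mult_right) (simp only: tr(2))
  also have "\<dots> = Gamma C * Gamma \<rho> * Gamma (\<sigma> - B) * rGamma \<sigma> * rGamma (C + \<rho> - B) *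
      (of_real (1 - z) powr (- \<sigma>) * of_real (1 - z) powr \<rho>) * hyp2F1 \<rho> A (C + \<rho> - B) (of_real z)"
    unfolding pf by (simp add: mult_ac)
  finally show "(LBINT s:{0<..<1}. f s) =
           Gamma C * Gamma \<rho> * Gamma (C + \<rho> - A - B) * rGamma (C + \<rho> - A) * rGamma (C + \<rho> - B) *
           of_real (1 - z) powr (A - C) * hyp2F1 \<rho> A (C + \<rho> - B) (of_real z)"
    unfolding pw unfolding \<sigma>_def .
qed

section \<open>The substitution y = 1/s\<close>

text \<open>The substitution is carried out with the increasing map \<open>inverse (1 - t)\<close>,
  whose derivative is nonnegative, and then reflected. Integrability on the half-line comes first,
  from the substitution rule for the nonnegative function \<open>norm (h y)\<close>.\<close>

lemma set_integral_inverse_substitution: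
  fixes h :: "real \<Rightarrow> complex"
  assumes cont: "continuous_on {1<..} h"
    and int: "set_integrable lborel {0<..<1} (\<lambda>s. of_real (inverse (s^2)) * h (inverse s))"
  shows "set_integrable lborel {1<..} h"
    and "(LBINT y:{1<..}. h y) = (LBINT s:{0<..<1}. of_real (inverse (s^2)) * h (inverse s))"
proof -
  define g where "g = (\<lambda>t::real. inverse (1 - t))"
  define g' where "g' = (\<lambda>t::real. inverse ((1 - t)^2))"
  have e1: "einterval (ereal 0) (ereal 1) = {0<..<1}" by (auto simp: einterval_def)
  have e2: "einterval (ereal 1) \<infinity> = {1<..}" by (auto simp: einterval_def)
  have int': "set_integrable lborel {0<..<1} (\<lambda>t. g' t *\<^sub>R h (g t))"
    using int set_integral_reflect_unit(1)[of "\<lambda>s. of_real (inverse (s^2)) * h (inverse s)"]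
    by (simp add: g_def g'_def scaleR_conv_of_real)
  have g1: "g t > 1" if "0 < t" "t < 1" for t using that by (simp add: g_def one_less_inverse)
  have d: "DERIV g t :> g' t" if "ereal 0 < ereal t" "ereal t < ereal 1" for t
    using that unfolding g_def g'_def by (auto intro!: derivative_eq_intros simp: power2_eq_square)
  have ch: "isCont h (g t)" if "ereal 0 < ereal t" "ereal t < ereal 1" for t
    using cont g1[of t] that by (auto simp: continuous_on_eq_continuous_at)
  have cg': "isCont g' t" if "ereal 0 < ereal t" "ereal t < ereal 1" for t
    using that unfolding g'_def by (auto intro!: continuous_intros)
  have g'0: "0 \<le> g' t" for t by (simp add: g'_def)
  have "(g \<longlongrightarrow> 1) (at_right 0)" unfolding g_def by real_asymp
  hence A: "((ereal \<circ> g \<circ> real_of_ereal) \<longlongrightarrow> ereal 1) (at_right (ereal 0))"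
    by (simp add: ereal_tendsto_simps)
  have "filterlim g at_top (at_left 1)" unfolding g_def by real_asymp
  hence B: "((ereal \<circ> g \<circ> real_of_ereal) \<longlongrightarrow> \<infinity>) (at_left (ereal 1))"
    by (simp add: ereal_tendsto_simps)
  have "set_integrable lborel (einterval (ereal 1) \<infinity>) (\<lambda>y. norm (h y))"
  proof (rule interval_integral_substitution_nonneg(1)[of "ereal 0" "ereal 1" g g' "\<lambda>y. norm (h y)" "ereal 1" \<infinity>, OF _ d])
    show "set_integrable lborel (einterval (ereal 0) (ereal 1)) (\<lambda>t. norm (h (g t)) * g' t)"
      using set_integrable_norm[OF int'] g'0 by (simp add: e1 mult.commute)
  qed (use ch cg' g'0 A B in \<open>auto intro!: continuous_intros\<close>)
  hence n: "set_integrable lborel {1<..} (\<lambda>y. norm (h y))" by (simp add: e2)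
  have meas: "set_borel_measurable lborel {1<..} h"
    using borel_measurable_continuous_on_indicator[OF _ cont] by (simp add: set_borel_measurable_def)
  show i: "set_integrable lborel {1<..} h"
    by (rule set_integrable_bound[OF n meas]) auto
  have "(LBINT y=ereal 1..\<infinity>. h y) = (LBINT t=ereal 0..ereal 1. g' t *\<^sub>R h (g t))"
    using d ch cg' g'0 A B int' i by (intro interval_integral_substitution_integrable) (auto simp: e1 e2)
  hence "(LBINT y:{1<..}. h y) = (LBINT t:{0<..<1}. g' t *\<^sub>R h (g t))"
    by (simp add: interval_lebesgue_integral_def e1[simplified] e2[simplified])
  also have "\<dots> = (LBINT s:{0<..<1}. of_real (inverse (s^2)) * h (inverse s))"
    using set_integral_reflect_unit(2)[of "\<lambda>s. of_real (inverse (s^2)) * h (inverse s)"]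
    by (simp add: g_def g'_def scaleR_conv_of_real)
  finally show "(LBINT y:{1<..}. h y) = (LBINT s:{0<..<1}. of_real (inverse (s^2)) * h (inverse s))" .
qed

section \<open>The integrals of \<open>w2\<close> and \<open>w4\<close>\<close>

text \<open>The common integral at \<open>A = a - c + 1\<close>, \<open>B = b - c + 1\<close>,
  \<open>C = 2 - c\<close>, \<open>\<rho> = a - \<mu>\<close> and \<open>z = 1/x\<close>, for which
  \<sigma> is \<open>1 - \<mu>\<close>. Taking \<bar>x\<bar> out of \<bar>x - y\<bar> gives the
  kernel, and its power recombines into those of \<bar>x - 1\<bar> and of \<open>w3\<close>.\<close>

lemma w2_integral:
  assumes \<delta>: "0 < Re (c - b - \<mu>)" and \<rho>: "0 < Re (a - \<mu>)" and C: "0 < Re (2 - c)"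
    and r: "a - \<mu> - b + 1 \<notin> \<int>\<^sub>\<le>\<^sub>0" and x: "x \<in> {..<0} \<union> {1<..}"
  defines "h \<equiv> (\<lambda>y. of_real (1 - y) powr (a - \<mu> - 1) * w2 y a b c * of_real \<bar>x - y\<bar> powr (\<mu> - 1))"
  shows "set_integrable lborel {0<..<1} h \<and>
          (LBINT y:{0<..<1}. h y) =
            Gamma (c - b - \<mu>) * Gamma (a - \<mu>) * Gamma (2 - c) * rGamma (a - b - \<mu> + 1) * rGamma (1 - \<mu>) *
            of_real \<bar>x - 1\<bar> powr (a - 1) * w3 x (a - \<mu>) b (c - \<mu>)"
proof -
  define f where "f = (\<lambda>s. of_real s powr (2 - c - 1) * of_real (1 - s) powr (a - \<mu> - 1) *
      hyp2F1 (a - c + 1) (b - c + 1) (2 - c) (of_real s) *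
      of_real (1 - inverse x * s) powr (- (2 - c + (a - \<mu>) - (a - c + 1))))"
  \<comment> \<open>The second equation takes over from the first when the third has already
    rewritten the subterm common to both.\<close>
  have e: "2 - c + (a - \<mu>) - (a - c + 1) - (b - c + 1) = c - b - \<mu>"
    "1 - \<mu> - (b - c + 1) = c - b - \<mu>" "2 - c + (a - \<mu>) - (a - c + 1) = 1 - \<mu>"
    "2 - c + (a - \<mu>) - (b - c + 1) = a - \<mu> - b + 1" "a - c + 1 - (2 - c) = a - 1"
    by simp_all
  have z: "inverse x < 1" using x by (auto simp: inverse_less_1_iff)
  have x0: "\<bar>x\<bar> > 0" using x by auto
  have core: "set_integrable lborel {0<..<1} f"
    "(LBINT s:{0<..<1}. f s) =
       Gamma (2 - c) * Gamma (a - \<mu>) * Gamma (c - b - \<mu>) * rGamma (1 - \<mu>) * rGamma (a - \<mu> - b + 1) *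
       of_real (1 - inverse x) powr (a - 1) * hyp2F1 (a - \<mu>) (a - c + 1) (a - \<mu> - b + 1) (of_real (inverse x))"
    using hypergeo_fractional_integral[OF C \<rho> _ _ z, of "a - c + 1" "b - c + 1", unfolded e, OF \<delta> r]
    unfolding f_def e by auto
  have hf: "h y = of_real \<bar>x\<bar> powr (\<mu> - 1) * f y" if y: "y \<in> {0<..<1}" for y
  proof -
    have eq: "\<bar>x - y\<bar> = \<bar>x\<bar> * (1 - inverse x * y)" using x y by (auto simp: field_simps)
    have "\<bar>x - y\<bar> > 0" using x y by auto
    hence pos: "1 - inverse x * y > 0" unfolding eq using x0 by (simp add: zero_less_mult_iff)
    have "(of_real \<bar>x - y\<bar> :: complex) powr (\<mu> - 1) = of_real \<bar>x\<bar> powr (\<mu> - 1) * of_real (1 - inverse x * y) powr (\<mu> - 1)"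
      unfolding eq by (rule powr_mult_pos[OF x0 pos])
    thus ?thesis using y unfolding h_def f_def w2_def e by simp
  qed
  have hi: "set_integrable lborel {0<..<1} h"
    using set_integrable_mult_right[OF core(1), of "of_real \<bar>x\<bar> powr (\<mu> - 1)"]
      set_integrable_cong[of lborel lborel "{0<..<1}" "{0<..<1}" h, OF refl refl hf] by simp
  have "(LBINT y:{0<..<1}. h y) = (LBINT y:{0<..<1}. of_real \<bar>x\<bar> powr (\<mu> - 1) * f y)"
    using hf by (intro set_lebesgue_integral_cong) auto
  also have "\<dots> = of_real \<bar>x\<bar> powr (\<mu> - 1) * (LBINT y:{0<..<1}. f y)"
    by (rule set_integral_mult_right)
  finally have hv: "(LBINT y:{0<..<1}. h y) = of_real \<bar>x\<bar> powr (\<mu> - 1) * (LBINT y:{0<..<1}. f y)" .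
  have eq1: "\<bar>x - 1\<bar> = \<bar>x\<bar> * (1 - inverse x)" using x by (auto simp: field_simps)
  have p1: "(of_real \<bar>x - 1\<bar> :: complex) powr (a - 1) = of_real \<bar>x\<bar> powr (a - 1) * of_real (1 - inverse x) powr (a - 1)"
    unfolding eq1 using x0 z by (intro powr_mult_pos) auto
  have p2: "(of_real \<bar>x\<bar> :: complex) powr (\<mu> - 1) = of_real \<bar>x\<bar> powr (a - 1) * of_real \<bar>x\<bar> powr (- (a - \<mu>))"
    by (subst powr_add[symmetric]) simp
  have e': "a - \<mu> - (c - \<mu>) + 1 = a - c + 1" "a - b - \<mu> + 1 = a - \<mu> - b + 1" by simp_all
  show ?thesis using hi unfolding hv core(2) w3_def p1 p2 e' by (simp add: mult_ac)
qed

lemma continuous_on_hyp2F1: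
  assumes "c \<notin> \<int>\<^sub>\<le>\<^sub>0"
  shows "continuous_on cut_plane (hyp2F1 a b c)"
  using hyp_continuation_hyp2F1[OF assms, of a b]
  by (auto simp: hyp_continuation_def intro: holomorphic_on_imp_continuous_on)

text \<open>With \<open>y = 1/s\<close> this is the common integral at \<open>A = b\<close>,
  \<open>B = b - c + 1\<close>, \<open>C = b - a + 1\<close>, \<open>\<rho> = a - \<mu>\<close> and
  \<open>z = x\<close>, again with \<sigma> equal to \<open>1 - \<mu>\<close>.\<close>

lemma w4_integral:
  assumes \<delta>: "0 < Re (c - b - \<mu>)" and \<rho>: "0 < Re (a - \<mu>)" and C: "0 < Re (b - a + 1)"
    and r: "c - \<mu> \<notin> \<int>\<^sub>\<le>\<^sub>0" and x: "x < 1"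
  defines "h \<equiv> (\<lambda>y. of_real (y - 1) powr (a - \<mu> - 1) * w4 y a b c * of_real (y - x) powr (\<mu> - 1))"
  shows "set_integrable lborel {1<..} h \<and>
          (LBINT y:{1<..}. h y) =
            Gamma (c - b - \<mu>) * Gamma (a - \<mu>) * Gamma (b - a + 1) * rGamma (c - \<mu>) * rGamma (1 - \<mu>) *
            of_real \<bar>1 - x\<bar> powr (a - 1) * w1 x (a - \<mu>) b (c - \<mu>)"
proof -
  define f where "f = (\<lambda>s. of_real s powr (b - a + 1 - 1) * of_real (1 - s) powr (a - \<mu> - 1) *
      hyp2F1 b (b - c + 1) (b - a + 1) (of_real s) *
      of_real (1 - x * s) powr (- (b - a + 1 + (a - \<mu>) - b)))"
  have e: "b - a + 1 + (a - \<mu>) - b - (b - c + 1) = c - b - \<mu>"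
    "1 - \<mu> - (b - c + 1) = c - b - \<mu>" "b - a + 1 + (a - \<mu>) - b = 1 - \<mu>"
    "b - a + 1 + (a - \<mu>) - (b - c + 1) = c - \<mu>" "b - (b - a + 1) = a - 1"
    by simp_all
  have core: "set_integrable lborel {0<..<1} f"
    "(LBINT s:{0<..<1}. f s) =
       Gamma (b - a + 1) * Gamma (a - \<mu>) * Gamma (c - b - \<mu>) * rGamma (1 - \<mu>) * rGamma (c - \<mu>) *
       of_real (1 - x) powr (a - 1) * hyp2F1 (a - \<mu>) b (c - \<mu>) (of_real x)"
    using hypergeo_fractional_integral[OF C \<rho> _ _ x, of b "b - c + 1", unfolded e, OF \<delta> r]
    unfolding f_def e by auto
  have hf: "of_real (inverse (s^2)) * h (inverse s) = f s" if s: "s \<in> {0<..<1}" for s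
  proof -
    have s0: "0 < s" "s < 1" using s by auto
    have xs: "1 - x * s > 0" using s0 x by (intro one_minus_mult_pos) auto
    have i: "of_real (inverse s) powr p = (of_real s powr (- p) :: complex)" for p
      using s0 by (simp add: powr_def Ln_of_real[symmetric] Ln_inverse)
    have q1: "inverse s - 1 = inverse s * (1 - s)" "inverse s - x = inverse s * (1 - x * s)"
      using s0 by (simp_all add: field_simps)
    have q2: "of_real (inverse s - 1) powr p = (of_real s powr (- p) * of_real (1 - s) powr p :: complex)" for p
      unfolding q1 using s0 by (subst powr_mult_pos) (auto simp only: i, auto)
    have q3: "of_real (inverse s - x) powr p = (of_real s powr (- p) * of_real (1 - x * s) powr p :: complex)" for p
      unfolding q1 using s0 xs by (subst powr_mult_pos) (auto simp only: i, auto)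
    have "complex_of_real s powr (- 2) = inverse (of_real s ^ 2)"
      using s0 powr_nat'[of "of_real s" 2] by (simp add: powr_minus)
    hence q4: "of_real (inverse (s^2)) = (of_real s powr (- 2) :: complex)" by simp
    \<comment> \<open>The powers of s come from the Jacobian, from \<open>y - 1\<close>, from the
      prefactor of \<open>w4\<close> and from \<open>y - x\<close>; together they give the exponent
      \<open>C - 1\<close>.\<close>
    have q5: "(of_real s powr (- 2) * of_real s powr (- (a - \<mu> - 1)) * of_real s powr b * of_real s powr (- (\<mu> - 1)) :: complex)
        = of_real s powr (b - a + 1 - 1)"
      by (simp only: powr_add[symmetric]) (simp add: algebra_simps)
    have q6: "of_real \<bar>inverse s\<bar> powr (- b) = (of_real s powr b :: complex)"
      using i[of "- b"] s0 by simp
    have "of_real (inverse (s^2)) * h (inverse s) =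
       (of_real s powr (- 2) * of_real s powr (- (a - \<mu> - 1)) * of_real s powr b * of_real s powr (- (\<mu> - 1))) *
       of_real (1 - s) powr (a - \<mu> - 1) * hyp2F1 b (b - c + 1) (b - a + 1) (of_real s) * of_real (1 - x * s) powr (\<mu> - 1)"
      unfolding h_def w4_def q2 q3 q4 q6 inverse_inverse_eq by (simp only: mult_ac)
    also have "\<dots> = f s" unfolding q5 f_def e by simp
    finally show ?thesis .
  qed
  have C': "b - a + 1 \<notin> \<int>\<^sub>\<le>\<^sub>0" using C by (rule Re_pos_not_nonpos_Int)
  have cont: "continuous_on {1<..} h"
  proof -
    have "continuous_on {1<..} (\<lambda>y. hyp2F1 b (b - c + 1) (b - a + 1) (of_real (inverse y)))"
      by (rule continuous_on_compose2[OF continuous_on_hyp2F1[OF C']])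
         (auto intro!: continuous_intros simp: of_real_in_cut_plane_iff inverse_less_1_iff simp del: of_real_inverse)
    thus ?thesis unfolding h_def w4_def using x
      by (intro continuous_intros) (auto simp: complex_nonpos_Reals_iff simp del: of_real_inverse)
  qed
  have "set_integrable lborel {0<..<1} (\<lambda>s. of_real (inverse (s^2)) * h (inverse s))"
    using core(1) set_integrable_cong[of lborel lborel "{0<..<1}" "{0<..<1}" _ f, OF refl refl hf] by simp
  note sub = set_integral_inverse_substitution[OF cont this]
  have "(LBINT y:{1<..}. h y) = (LBINT s:{0<..<1}. f s)"
    unfolding sub(2) using hf by (intro set_lebesgue_integral_cong) auto
  thus ?thesis using sub(1) x unfolding core(2) w1_def by (simp add: mult_ac)
qed

section \<open>Symmetry in a and b, and the four identities\<close>

lemma w1_commute: "w1 x a b c = w1 x b a c"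
  by (simp add: w1_def hyp2F1_commute[of a])

lemma w2_commute: "w2 x a b c = w2 x b a c"
  by (simp add: w2_def hyp2F1_commute[of "a - c + 1"])

lemma w3_eq_w4: "w3 x a b c = w4 x b a c"
  by (simp add: w3_def w4_def)


theorem mainTheorem15:
  fixes a b c \<mu> :: complex
  shows "
    (0 < Re (c - b - \<mu>) \<and> 0 < Re (a - \<mu>) \<and> 0 < Re (2 - c) \<and>
       2 - c \<notin> \<int>\<^sub>\<le>\<^sub>0 \<and> a - \<mu> - b + 1 \<notin> \<int>\<^sub>\<le>\<^sub>0 \<longrightarrow>
       (\<forall>x\<in>{..<0} \<union> {1<..}.
          set_integrable lborel {0<..<1} (\<lambda>y. of_real (1 - y) powr (a - \<mu> - 1) * w2 y a b c * of_real \<bar>x - y\<bar> powr (\<mu> - 1)) \<and>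
          (LBINT y:{0<..<1}. of_real (1 - y) powr (a - \<mu> - 1) * w2 y a b c * of_real \<bar>x - y\<bar> powr (\<mu> - 1)) =
            Gamma (c - b - \<mu>) * Gamma (a - \<mu>) * Gamma (2 - c) * rGamma (a - b - \<mu> + 1) * rGamma (1 - \<mu>) *
            of_real \<bar>x - 1\<bar> powr (a - 1) * w3 x (a - \<mu>) b (c - \<mu>))) \<and>
    (0 < Re (c - b - \<mu>) \<and> 0 < Re (a - \<mu>) \<and> 0 < Re (b - a + 1) \<and>
       b - a + 1 \<notin> \<int>\<^sub>\<le>\<^sub>0 \<and> c - \<mu> \<notin> \<int>\<^sub>\<le>\<^sub>0 \<longrightarrow>
       (\<forall>x\<in>{..<0} \<union> {0<..<1}.
          set_integrable lborel {1<..} (\<lambda>y. of_real (y - 1) powr (a - \<mu> - 1) * w4 y a b c * of_real (y - x) powr (\<mu> - 1)) \<and>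
          (LBINT y:{1<..}. of_real (y - 1) powr (a - \<mu> - 1) * w4 y a b c * of_real (y - x) powr (\<mu> - 1)) =
            Gamma (c - b - \<mu>) * Gamma (a - \<mu>) * Gamma (b - a + 1) * rGamma (c - \<mu>) * rGamma (1 - \<mu>) *
            of_real \<bar>1 - x\<bar> powr (a - 1) * w1 x (a - \<mu>) b (c - \<mu>))) \<and>
    (0 < Re (c - a - \<mu>) \<and> 0 < Re (b - \<mu>) \<and> 0 < Re (2 - c) \<and>
       2 - c \<notin> \<int>\<^sub>\<le>\<^sub>0 \<and> b - \<mu> - a + 1 \<notin> \<int>\<^sub>\<le>\<^sub>0 \<longrightarrow>
       (\<forall>x\<in>{..<0} \<union> {1<..}.
          set_integrable lborel {0<..<1} (\<lambda>y. of_real (1 - y) powr (b - \<mu> - 1) * w2 y a b c * of_real \<bar>x - y\<bar> powr (\<mu> - 1)) \<and>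
          (LBINT y:{0<..<1}. of_real (1 - y) powr (b - \<mu> - 1) * w2 y a b c * of_real \<bar>x - y\<bar> powr (\<mu> - 1)) =
            Gamma (c - a - \<mu>) * Gamma (b - \<mu>) * Gamma (2 - c) * rGamma (b - a - \<mu> + 1) * rGamma (1 - \<mu>) *
            of_real \<bar>x - 1\<bar> powr (b - 1) * w4 x a (b - \<mu>) (c - \<mu>))) \<and>
    (0 < Re (c - a - \<mu>) \<and> 0 < Re (b - \<mu>) \<and> 0 < Re (a - b + 1) \<and>
       a - b + 1 \<notin> \<int>\<^sub>\<le>\<^sub>0 \<and> c - \<mu> \<notin> \<int>\<^sub>\<le>\<^sub>0 \<longrightarrow>
       (\<forall>x\<in>{..<0} \<union> {0<..<1}.
          set_integrable lborel {1<..} (\<lambda>y. of_real (y - 1) powr (b - \<mu> - 1) * w3 y a b c * of_real (y - x) powr (\<mu> - 1)) \<and>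
          (LBINT y:{1<..}. of_real (y - 1) powr (b - \<mu> - 1) * w3 y a b c * of_real (y - x) powr (\<mu> - 1)) =
            Gamma (c - a - \<mu>) * Gamma (b - \<mu>) * Gamma (a - b + 1) * rGamma (c - \<mu>) * rGamma (1 - \<mu>) *
            of_real \<bar>1 - x\<bar> powr (b - 1) * w1 x a (b - \<mu>) (c - \<mu>)))"
\<comment> \<open>The goals come in pairs, integrability and value. The last two identities are the
  first two with a and b exchanged, which fixes \<open>w2\<close>, turns \<open>w3\<close> into
  \<open>w4\<close> and swaps the upper parameters of \<open>w1\<close>.\<close>
proof (intro conjI impI ballI, goal_cases)
  case (1 x) thus ?case using w2_integral[of c b \<mu> a x] by blast
next
  case (2 x) thus ?case using w2_integral[of c b \<mu> a x] by blast
next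
  case (3 x) thus ?case using w4_integral[of c b \<mu> a x] by auto
next
  case (4 x) thus ?case using w4_integral[of c b \<mu> a x] by auto
next
  case (5 x) thus ?case
    using w2_integral[of c a \<mu> b x] unfolding w2_commute[of _ b a] w3_eq_w4 by blast
next
  case (6 x) thus ?case
    using w2_integral[of c a \<mu> b x] unfolding w2_commute[of _ b a] w3_eq_w4 by blast
next
  case (7 x) thus ?case
    using w4_integral[of c a \<mu> b x] unfolding w1_commute[of x a] w3_eq_w4 by auto
next
  case (8 x) thus ?case
    using w4_integral[of c a \<mu> b x] unfolding w1_commute[of x a] w3_eq_w4 by auto
qed

end
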